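(* Let $s_1,s_2\in\mathbb{R}$, $0<p_1,p_2<\infty$, $0<q_1\le\infty$ and define $\alpha=p_1\big(\frac{s_2-s_1}{d}-\frac1{p_2}\big)+1$. For $\Gamma\subset\mathcal{D}$ (the dyadic cubes of $\mathbb{R}^d$) define $\nu_\alpha(\Gamma)=\sum_{Q\in\Gamma}|Q|^\alpha$. Given $\xi>0$, define $\tau$ by $\frac1\tau=\xi+\frac1{p_1}$. If $\alpha\ne1$, then $$\mathcal{A}^\xi_\tau(f^{s_1}_{p_1,q_1},\nu_\alpha)=b^\gamma_{\tau,\tau}\quad\text{(equivalent quasi-norms)},$$ where $\gamma=s_1+d\xi(1-\alpha)$. If $\alpha=1$, the same result holds, with $\gamma=s_1$, provided $p_1=q_1$.
   Context: $\mathcal{D}$ is the set of dyadic cubes $Q_{j,k}=2^{-j}([0,1)^d+k)$, $j\in\mathbb{Z}$, $k\in\mathbb{Z}^d$, of $\mathbb{R}^d$; $|Q|$ is the Lebesgue measure of $Q$; $S=\mathbb{C}^{\mathcal{D}}$; $\mathbf{e}_Q\in S$ has entry $1$ at $Q$ and $0$ elsewhere. For $\Gamma\subset\mathcal{D}$ (possibly infinite), $\sum_{Q\in\Gamma}t_Q\mathbf{e}_Q$ denotes the sequence with entry $t_Q$ for $Q\in\Gamma$ and $0$ otherwise. For $s\in\mathbb{R}$, $0<p<\infty$, $0<r\le\infty$, $f^s_{p,r}$ is the space of $\mathbf{s}=\{s_Q\}\in S$ with $$\|\mathbf{s}\|_{f^s_{p,r}}=\Big\|\Big[\sum_{Q\in\mathcal{D}}\big(|Q|^{-s/d+1/r-1/2}|s_Q|\chi^{(r)}_Q(\cdot)\big)^r\Big]^{1/r}\Big\|_{L^p(\mathbb{R}^d)}<\infty,\qquad\chi^{(r)}_Q=\chi_Q|Q|^{-1/r}$$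 (supremum instead of the inner sum, and $1/r=0$, if $r=\infty$); the quasi-norm is $\infty$ for sequences not in the space. For $s\in\mathbb{R}$, $0<p,r\le\infty$, $b^s_{p,r}$ is the space of $\mathbf{s}\in S$ with $$\|\mathbf{s}\|_{b^s_{p,r}}=\Big[\sum_{j\in\mathbb{Z}}\Big(\sum_{|Q|=2^{-jd}}(|Q|^{-s/d+1/p-1/2}|s_Q|)^p\Big)^{r/p}\Big]^{1/r}<\infty$$ (obvious modifications if $p$ or $r$ is $\infty$). For a sequence space $f$ and a measure $\nu$ on $\mathcal{D}$: $\Sigma_{t,\nu}=\{\sum_{Q\in\Gamma}t_Q\mathbf{e}_Q:\nu(\Gamma)\le t\}$, $\sigma_\nu(t,\mathbf{s})=\inf_{\mathbf{t}\in\Sigma_{t,\nu}}\|\mathbf{s}-\mathbf{t}\|_f$ for $\mathbf{s}\in S$, and, for $0<\xi,\mu<\infty$, $\mathcal{A}^\xi_\mu(f,\nu)$ is the set of $\mathbf{s}\in S$ with $\|\mathbf{s}\|_{\mathcal{A}^\xi_\mu(f,\nu)}=\big(\int_0^\infty[t^\xi\sigma_\nu(t,\mathbf{s})]^\mu\frac{dt}{t}\big)^{1/\mu}<\infty$. *)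

theory Defs
  imports "HOL-Analysis.Analysis"
begin

definition dyadic_cube :: "int \<Rightarrow> int ^ 'n::finite \<Rightarrow> (real ^ 'n) set" where
  "dyadic_cube j k =
     (\<lambda>y. (2 powi (- j)) *\<^sub>R (y + (\<chi> i. real_of_int (k $ i)))) ` {y. \<forall>i. 0 \<le> y $ i \<and> y $ i < 1}"

typedef ('n::finite) dyadic = "{Q :: (real ^ 'n) set. \<exists>j k. Q = dyadic_cube j k}"
  morphisms cube_set Abs_dyadic
  by blast

definition vol :: "'n::finite dyadic \<Rightarrow> real" where
  "vol Q = measure lborel (cube_set Q)"

(* Complex-valued families indexed by all dyadic cubes; no summability is imposed. *)
type_synonym 'n dyadic_seq = "'n dyadic \<Rightarrow> complex"

(* Power with a positive real exponent; the value for a <= 0 is irrelevant. *)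
definition ennpow :: "ennreal \<Rightarrow> real \<Rightarrow> ennreal" where
  "ennpow x a = (if x = \<infinity> then \<infinity> else ennreal (enn2real x powr a))"

(* The l^r quasi-norm over the index set A, 0 < r <= infinity.
   The integral against counting measure is the unordered sum with values in [0, infinity]. *)
definition lr_qnorm :: "ennreal \<Rightarrow> 'a set \<Rightarrow> ('a \<Rightarrow> ennreal) \<Rightarrow> ennreal" where
  "lr_qnorm r A f =
     (if r = \<infinity> then (SUP a\<in>A. f a)
      else ennpow (\<integral>\<^sup>+ a. ennpow (f a) (enn2real r) \<partial>count_space A) (1 / enn2real r))"

(* The real number 1/r, read as 0 for r = infinity. *)
definition recip :: "ennreal \<Rightarrow> real" where
  "recip r = (if r = \<infinity> then 0 else 1 / enn2real r)"

(* The quasi-norm takes the value infinity exactly off the space f^s_(p,r). *)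
definition f_qnorm :: "real \<Rightarrow> real \<Rightarrow> ennreal \<Rightarrow> 'n::finite dyadic_seq \<Rightarrow> ennreal" where
  "f_qnorm s p r u =
     ennpow
       (\<integral>\<^sup>+ x. ennpow
          (lr_qnorm r UNIV (\<lambda>Q. ennreal
             (vol Q powr (- s / real CARD('n) + recip r - 1 / 2) * cmod (u Q)
              * (indicator (cube_set Q) x * vol Q powr (- recip r))))) p
        \<partial>lborel)
       (1 / p)"

definition b_qnorm :: "real \<Rightarrow> ennreal \<Rightarrow> ennreal \<Rightarrow> 'n::finite dyadic_seq \<Rightarrow> ennreal" where
  "b_qnorm s p r u =
     lr_qnorm r (UNIV :: int set)
       (\<lambda>j. lr_qnorm p {Q. vol Q = 2 powr (- (real_of_int j * real CARD('n)))}
          (\<lambda>Q. ennreal (vol Q powr (- s / real CARD('n) + recip p - 1 / 2) * cmod (u Q))))"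

definition b_space :: "real \<Rightarrow> ennreal \<Rightarrow> ennreal \<Rightarrow> 'n::finite dyadic_seq set" where
  "b_space s p r = {u. b_qnorm s p r u < \<infinity>}"

definition nu :: "real \<Rightarrow> 'n::finite dyadic measure" where
  "nu \<alpha> = density (count_space UNIV) (\<lambda>Q. ennreal (vol Q powr \<alpha>))"

lemma emeasure_nu: "emeasure (nu \<alpha>) \<Gamma> = (\<integral>\<^sup>+ Q. ennreal (vol Q powr \<alpha>) \<partial>count_space \<Gamma>)"
  unfolding nu_def by (simp add: emeasure_density nn_integral_count_space_indicator)

(* Below a sequence space f enters through its quasi-norm N, extended by infinity off f. *)

definition Sigma_approx :: "'n::finite dyadic measure \<Rightarrow> real \<Rightarrow> 'n dyadic_seq set" where
  "Sigma_approx \<nu> t =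
     {\<lambda>Q. if Q \<in> \<Gamma> then c Q else 0 | \<Gamma> c. emeasure \<nu> \<Gamma> \<le> ennreal t}"

definition approx_error ::
  "('n::finite dyadic_seq \<Rightarrow> ennreal) \<Rightarrow> 'n dyadic measure \<Rightarrow> real \<Rightarrow> 'n dyadic_seq \<Rightarrow> ennreal" where
  "approx_error N \<nu> t u = (INF v\<in>Sigma_approx \<nu> t. N (\<lambda>Q. u Q - v Q))"

definition A_qnorm ::
  "real \<Rightarrow> real \<Rightarrow> ('n::finite dyadic_seq \<Rightarrow> ennreal) \<Rightarrow> 'n dyadic measure \<Rightarrow> 'n dyadic_seq \<Rightarrow> ennreal" where
  "A_qnorm \<xi> \<mu> N \<nu> u =
     ennpow
       (\<integral>\<^sup>+ t\<in>{0<..}. (ennpow (ennreal (t powr \<xi>) * approx_error N \<nu> t u) \<mu> * ennreal (1 / t)) \<partial>lborel)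
       (1 / \<mu>)"

definition A_space ::
  "real \<Rightarrow> real \<Rightarrow> ('n::finite dyadic_seq \<Rightarrow> ennreal) \<Rightarrow> 'n dyadic measure \<Rightarrow> 'n dyadic_seq set" where
  "A_space \<xi> \<mu> N \<nu> = {u. A_qnorm \<xi> \<mu> N \<nu> u < \<infinity>}"

definition equivalent_qnorms_on ::
  "'a set \<Rightarrow> ('a \<Rightarrow> ennreal) \<Rightarrow> ('a \<Rightarrow> ennreal) \<Rightarrow> bool" where
  "equivalent_qnorms_on X M N \<longleftrightarrow>
     (\<exists>c C :: real. 0 < c \<and> 0 < C \<and> (\<forall>u\<in>X. ennreal c * N u \<le> M u \<and> M u \<le> ennreal C * N u))"

end

theory Submission
  imports Defs
begin

text \<open>
  Write \<open>p = p1\<close>, \<open>q = q1\<close>, \<open>s = s1\<close> and \<open>\<beta> = (\<alpha> - 1) / p\<close>. With the normalised coefficients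
  \<open>g Q = |Q| powr (- s/d - 1/2 - \<beta>) * |u Q|\<close> the \<open>\<tau>\<close>-th power of the Besov quasi-norm is the integral
  of \<open>g powr \<tau>\<close> against \<open>\<nu>\<close>, and the Triebel-Lizorkin quasi-norm at \<open>x\<close> is the \<open>l^q\<close> norm of
  \<open>|Q| powr \<beta> * g Q\<close> over the cubes containing \<open>x\<close>. These cubes form a chain with one cube per level,
  so for \<open>\<alpha> \<noteq> 1\<close> the weights \<open>|Q| powr \<beta>\<close> are geometric along it, and sums are
  comparable to suprema; for \<open>\<alpha> = 1\<close> and \<open>q = p\<close> there is nothing to compare.

  Hence \<open>\<theta>^p * \<nu> {g > \<theta>} \<lesssim> \<parallel>u\<parallel>^p\<close>, and \<open>\<parallel>u\<parallel>^p \<lesssim> \<theta>^\<epsilon> * \<integral> g^(p - \<epsilon>) d\<nu>\<close> whenever \<open>g \<le> \<theta>\<close>. The first bound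
  gives \<open>\<nu> {g > \<theta>} \<le> t + C * (\<sigma> t / \<theta>)^p\<close>. The second bounds \<open>\<sigma> t\<close> by thresholding at a dyadic level \<open>2^k\<close>
  with \<open>\<nu> {g > 2^k} \<le> t < \<nu> {g > 2^(k-1)}\<close>. Summing either one over the dyadic levels yields the two
  inequalities between the quasi-norms.
\<close>

section \<open>Geometric sums and dyadic cubes\<close>

lemma ennpow_ennreal [simp]: "0 \<le> x \<Longrightarrow> ennpow (ennreal x) a = ennreal (x powr a)"
  by (simp add: ennpow_def)

lemma ennpow_top [simp]: "ennpow top a = top"
  by (simp add: ennpow_def)

lemma ennpow_0 [simp]: "ennpow 0 a = 0"
  by (simp add: ennpow_def)

lemma ennpow_1 [simp]: "ennpow x 1 = x"
  by (cases x) auto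

lemma ennpow_ennpow [simp]: "ennpow (ennpow x a) b = ennpow x (a * b)"
  by (cases x) (auto simp: powr_powr)

lemma ennpow_mono: "0 \<le> a \<Longrightarrow> x \<le> y \<Longrightarrow> ennpow x a \<le> ennpow y a"
  by (cases x; cases y) (auto simp: powr_mono2 top_unique)

lemma ennpow_mult: "0 < c \<Longrightarrow> ennpow (ennreal c * x) a = ennreal (c powr a) * ennpow x a"
  by (cases x) (auto simp: powr_mult ennreal_mult_top simp flip: ennreal_mult)

lemma ennpow_le_iff: "0 < a \<Longrightarrow> ennpow x a \<le> ennpow y a \<longleftrightarrow> x \<le> y"
  using ennpow_mono[of a x y] ennpow_mono[of "1/a" "ennpow x a" "ennpow y a"] by auto

lemma ennpow_le_swap: "0 < a \<Longrightarrow> ennpow x (1 / a) \<le> y \<longleftrightarrow> x \<le> ennpow y a"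
  using ennpow_le_iff[of a "ennpow x (1/a)" y] by simp

section \<open>Geometric sums over distinct integer levels\<close>

definition geom_const :: "real \<Rightarrow> real" where
  "geom_const c = 1 / (1 - 2 powr (- \<bar>c\<bar>))"

lemma geom_const_pos: "c \<noteq> 0 \<Longrightarrow> 0 < geom_const c"
  by (simp add: geom_const_def powr_less_one)

text \<open>Distinct levels pick distinct terms of a two-sided geometric progression, and all of
  them are at most \<open>M\<close>. The sum is therefore at most a full geometric series that
  starts at \<open>M\<close> and decreases with ratio 2 powr (-|c|), whose sum is
  \<open>geom_const c * M\<close>. The absolute value covers weights that grow with the level as
  well as weights that decay.\<close>

lemma geometric_sum_le:
  fixes l :: "'a \<Rightarrow> int"
  assumes c: "c \<noteq> 0" and inj: "inj_on l K" and M: "0 < M"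
    and le: "\<And>a. a \<in> K \<Longrightarrow> 2 powr (c * of_int (l a)) \<le> M"
  shows "(\<integral>\<^sup>+ a. ennreal (2 powr (c * of_int (l a))) \<partial>count_space K) \<le> ennreal (geom_const c * M)"
proof -
  define r where "r = 2 powr (- \<bar>c\<bar>)"
  have r: "0 < r" "r < 1" using c by (auto simp: r_def powr_less_one)
  \<comment> \<open>The sign of \<open>c\<close>: passing from \<open>l a\<close> to
    \<open>e * l a\<close> reduces to weights that increase with the level, with slope |c|.\<close>
  define e :: int where "e = (if c > 0 then 1 else -1)"
  have ce: "c * of_int i = \<bar>c\<bar> * of_int (e * i)" for i
    by (auto simp: e_def)
  \<comment> \<open>\<open>m\<close> is the largest integer with 2 powr (|c| * m) at most
    \<open>M\<close>; \<open>n a\<close> will count how far \<open>e * l a\<close> lies below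
    it.\<close>
  define m where "m = \<lfloor>log 2 M / \<bar>c\<bar>\<rfloor>"
  define n where "n a = nat (m - e * l a)" for a
  have lm: "e * l a \<le> m" if "a \<in> K" for a
  proof -
    have "\<bar>c\<bar> * of_int (e * l a) \<le> log 2 M"
      using le[OF that] M unfolding ce by (simp add: le_log_iff)
    then have "of_int (e * l a) \<le> log 2 M / \<bar>c\<bar>"
      using c by (simp add: field_simps)
    then show ?thesis unfolding m_def by linarith
  qed
  have inj_n: "inj_on n K"
  proof (rule inj_onI)
    fix a b assume "a \<in> K" "b \<in> K" "n a = n b"
    then have "e * l a = e * l b" using lm[of a] lm[of b] unfolding n_def by linarith
    then have "l a = l b" by (auto simp: e_def split: if_splits)
    with inj \<open>a \<in> K\<close> \<open>b \<in> K\<close> show "a = b" by (auto dest: inj_onD)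
  qed
  have term_le: "2 powr (c * of_int (l a)) \<le> M * r ^ n a" if "a \<in> K" for a
  proof -
    have "of_int m * \<bar>c\<bar> \<le> log 2 M"
      using c unfolding m_def by (simp flip: pos_le_divide_eq)
    then have mM: "2 powr (\<bar>c\<bar> * of_int m) \<le> M"
      using M by (simp add: le_log_iff mult.commute)
    have "c * of_int (l a) = \<bar>c\<bar> * of_int m + (- \<bar>c\<bar>) * real (n a)"
      unfolding ce using lm[OF that] by (simp add: n_def algebra_simps)
    then have "2 powr (c * of_int (l a)) = 2 powr (\<bar>c\<bar> * of_int m) * r ^ n a"
      unfolding r_def by (simp only: powr_add powr_powr[symmetric] powr_realpow) (simp add: powr_realpow)
    also have "\<dots> \<le> M * r ^ n a" using mM r by (intro mult_right_mono) auto
    finally show ?thesis .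
  qed
  have "(\<integral>\<^sup>+ a. ennreal (2 powr (c * of_int (l a))) \<partial>count_space K)
      \<le> (\<integral>\<^sup>+ a. ennreal (M * r ^ n a) \<partial>count_space K)"
    by (intro nn_integral_mono ennreal_leI) (use term_le in auto)
  also have "\<dots> = (\<integral>\<^sup>+ i. ennreal (M * r ^ i) \<partial>count_space (n ` K))"
    using inj_n by (intro nn_integral_bij_count_space) (auto simp: bij_betw_def)
  also have "\<dots> \<le> (\<integral>\<^sup>+ i. ennreal (M * r ^ i) \<partial>count_space UNIV)"
    by (subst nn_integral_count_space_indicator)
      (auto intro!: nn_integral_mono simp: indicator_def)
  also have "\<dots> = (\<Sum>i. ennreal (M * r ^ i))"
    by (rule nn_integral_count_space_nat)
  also have "\<dots> = ennreal (\<Sum>i. M * r ^ i)"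
    using r M by (intro suminf_ennreal2 summable_mult summable_geometric) auto
  also have "(\<Sum>i. M * r ^ i) = geom_const c * M"
    using r by (simp add: suminf_mult suminf_geometric summable_geometric geom_const_def r_def)
  finally show ?thesis .
qed

section \<open>Dyadic cubes, their volumes and their levels\<close>

lemma mem_dyadic_cube:
  "x \<in> dyadic_cube j k \<longleftrightarrow> (\<forall>i. \<lfloor>2 powi j * x $ i\<rfloor> = k $ i)"
proof -
  have pos: "(0::real) < 2 powi j" by simp
  have inv: "(2::real) powi (- j) * 2 powi j = 1"
    by (simp flip: power_int_add)
  show ?thesis
  proof
    assume "x \<in> dyadic_cube j k"
    then obtain y where y: "\<And>i. 0 \<le> y $ i \<and> y $ i < 1"
      "x = (2 powi (- j)) *\<^sub>R (y + (\<chi> i. real_of_int (k $ i)))"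
      unfolding dyadic_cube_def by auto
    have "2 powi j * x $ i = y $ i + of_int (k $ i)" for i
      unfolding y(2) using inv by (simp add: mult.assoc[symmetric] mult.commute)
    then show "\<forall>i. \<lfloor>2 powi j * x $ i\<rfloor> = k $ i"
      using y(1) by (simp add: floor_eq_iff)
  next
    assume k: "\<forall>i. \<lfloor>2 powi j * x $ i\<rfloor> = k $ i"
    define y :: "real ^ 'a" where "y = (\<chi> i. 2 powi j * x $ i - of_int (k $ i))"
    have "0 \<le> y $ i \<and> y $ i < 1" for i
      using k[rule_format, of i] unfolding y_def by (simp add: floor_eq_iff)
    moreover have "x = (2 powi (- j)) *\<^sub>R (y + (\<chi> i. real_of_int (k $ i)))"
      using inv by (simp add: vec_eq_iff y_def mult.assoc[symmetric])
    ultimately show "x \<in> dyadic_cube j k"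
      unfolding dyadic_cube_def by blast
  qed
qed

text \<open>The half-open cube lies between an open and a closed box with the same corners, and both
  boxes have the same measure.\<close>

lemma dyadic_cube_measure:
  fixes k :: "int ^ 'n::finite"
  shows "dyadic_cube j k \<in> sets borel"
    and "emeasure lborel (dyadic_cube j k) = ennreal (2 powr (- (of_int j * real CARD('n))))"
proof -
  define t :: real where "t = 2 powi (- j)"
  have t: "0 < t" "2 powi j = 1 / t"
    by (auto simp: t_def power_int_minus field_simps)
  define a b :: "real ^ 'n" where "a = (\<chi> i. t * of_int (k $ i))"
    and "b = (\<chi> i. t * (of_int (k $ i) + 1))"
  have eq: "dyadic_cube j k = {x. \<forall>i. a $ i \<le> x $ i \<and> x $ i < b $ i}"
  proof -
    have "\<lfloor>2 powi j * x $ i\<rfloor> = k $ i \<longleftrightarrow> a $ i \<le> x $ i \<and> x $ i < b $ i" for x :: "real ^ 'n" and i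
      unfolding t(2) floor_eq_iff using t(1) by (simp add: a_def b_def field_simps)
    then show ?thesis by (auto simp: mem_dyadic_cube)
  qed
  show meas: "dyadic_cube j k \<in> sets borel"
    unfolding eq by measurable
  have ba: "(b - a) \<bullet> e = t" if "e \<in> Basis" for e
    using that by (auto simp: Basis_vec_def inner_axis a_def b_def algebra_simps)
  have ab: "a \<bullet> e \<le> b \<bullet> e" if "e \<in> Basis" for e
    using ba[OF that] t by (simp add: inner_diff_left)
  have prod: "(\<Prod>e\<in>Basis. (b - a) \<bullet> e) = t ^ CARD('n)"
    using ba by simp
  have sub: "box a b \<subseteq> dyadic_cube j k" "dyadic_cube j k \<subseteq> cbox a b"
    unfolding eq by (auto simp: mem_box_cart less_imp_le)
  have "emeasure lborel (dyadic_cube j k) = ennreal (t ^ CARD('n))"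
  proof (rule antisym)
    show "emeasure lborel (dyadic_cube j k) \<le> ennreal (t ^ CARD('n))"
      using emeasure_mono[OF sub(2), of lborel] ab prod by (simp add: emeasure_lborel_cbox)
    show "ennreal (t ^ CARD('n)) \<le> emeasure lborel (dyadic_cube j k)"
      using emeasure_mono[OF sub(1), of lborel] ab prod meas by (simp add: emeasure_lborel_box)
  qed
  also have "t ^ CARD('n) = 2 powr (- (of_int j * real CARD('n)))"
    unfolding t_def
    by (simp add: powr_powr flip: powr_realpow powr_real_of_int')
  finally show "emeasure lborel (dyadic_cube j k) = ennreal (2 powr (- (of_int j * real CARD('n))))" .
qed

text \<open>A cube is only a set, so its scale has to be recovered by choice. The choice is
  harmless: by \<open>vol_level\<close> the volume determines the level.\<close>

definition level :: "'n::finite dyadic \<Rightarrow> int" where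
  "level Q = (SOME j. \<exists>k. cube_set Q = dyadic_cube j k)"

lemma cube_set_level: "\<exists>k. cube_set Q = dyadic_cube (level Q) k"
  unfolding level_def using cube_set[of Q] by (rule_tac someI_ex) blast

lemma vol_level: "vol (Q :: 'n::finite dyadic) = 2 powr (- (of_int (level Q) * real CARD('n)))"
  using cube_set_level[of Q] by (auto simp: vol_def measure_def dyadic_cube_measure)

lemma vol_pos [simp]: "0 < vol Q"
  by (simp add: vol_level)

lemma vol_nonneg [simp]: "0 \<le> vol Q" and vol_nonzero [simp]: "vol Q \<noteq> 0"
  using vol_pos[of Q] by linarith+

lemma cube_set_borel [measurable]: "cube_set Q \<in> sets borel"
  using cube_set_level[of Q] by (auto simp: dyadic_cube_measure)

lemma emeasure_cube_set: "emeasure lborel (cube_set Q) = ennreal (vol Q)"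
  using cube_set_level[of Q] by (auto simp: vol_level dyadic_cube_measure)

text \<open>At a fixed level \<open>j\<close> the index \<open>k\<close> of a cube containing
  \<open>x\<close> is forced, since its coordinates are the floors of those of 2^j x. So the cubes
  containing a point are labelled by distinct levels, as \<open>geometric_sum_le\<close>
  requires.\<close>

lemma inj_on_level: "inj_on level {Q. x \<in> cube_set Q}"
proof (rule inj_onI)
  fix Q R assume "Q \<in> {Q. x \<in> cube_set Q}" "R \<in> {Q. x \<in> cube_set Q}" and eq: "level Q = level R"
  then have x: "x \<in> cube_set Q" "x \<in> cube_set R" by auto
  obtain k k' where k: "cube_set Q = dyadic_cube (level Q) k" "cube_set R = dyadic_cube (level R) k'"
    using cube_set_level by blast
  have "k = k'" using x unfolding k eq by (simp add: mem_dyadic_cube vec_eq_iff)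
  with k eq show "Q = R" by (simp flip: cube_set_inject)
qed

text \<open>Countability allows sums over all cubes to be exchanged with Lebesgue integrals.\<close>

instance dyadic :: (finite) countable
proof
  define f :: "'a dyadic \<Rightarrow> int \<times> (int ^ 'a)"
    where "f Q = (level Q, SOME k. cube_set Q = dyadic_cube (level Q) k)" for Q
  have "cube_set Q = dyadic_cube (fst (f Q)) (snd (f Q))" for Q
    unfolding f_def using someI_ex[OF cube_set_level[of Q]] by simp
  then have "inj f" by (metis cube_set_inject injI)
  then show "\<exists>to_nat :: 'a dyadic \<Rightarrow> nat. inj to_nat"
    using inj_compose[OF inj_to_nat] by blast
qed

section \<open>Norms along a chain of cubes\<close>

lemma nn_integral_count_space_mono_set:
  "A \<subseteq> B \<Longrightarrow> (\<integral>\<^sup>+ x. f x \<partial>count_space A) \<le> (\<integral>\<^sup>+ x. f x \<partial>count_space B)"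
  by (simp add: nn_integral_count_space_indicator)
    (auto intro!: nn_integral_mono simp: indicator_def)

lemma lr_qnorm_cong: "(\<And>a. a \<in> A \<Longrightarrow> f a = g a) \<Longrightarrow> lr_qnorm r A f = lr_qnorm r A g"
  by (auto simp: lr_qnorm_def intro!: arg_cong2[where f = ennpow] nn_integral_cong SUP_cong)

lemma lr_qnorm_0 [simp]: "lr_qnorm r A (\<lambda>_. 0) = 0"
  using SUP_bot[of A, where 'a = ennreal] by (simp add: lr_qnorm_def bot_ennreal)

lemma lr_qnorm_restrict:
  assumes "\<And>a. a \<notin> K \<Longrightarrow> f a = 0"
  shows "lr_qnorm r UNIV f = lr_qnorm r K f"
proof (cases "r = \<infinity>")
  case True
  have "(SUP a. f a) = (SUP a\<in>K. f a)"
  proof (rule antisym)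
    have "f a \<le> (SUP a\<in>K. f a)" for a
      using assms[of a] by (cases "a \<in> K") (auto intro: SUP_upper)
    then show "(SUP a. f a) \<le> (SUP a\<in>K. f a)" by (intro SUP_least)
  qed (auto intro: SUP_subset_mono)
  with True show ?thesis by (simp add: lr_qnorm_def)
next
  case False
  have "(\<integral>\<^sup>+ a. ennpow (f a) (enn2real r) \<partial>count_space UNIV)
      = (\<integral>\<^sup>+ a. ennpow (f a) (enn2real r) \<partial>count_space K)"
    by (subst (2) nn_integral_count_space_indicator)
      (auto intro!: nn_integral_cong simp: assms indicator_def)
  with False show ?thesis by (simp add: lr_qnorm_def)
qed

lemma enn2real_pos: "0 < r \<Longrightarrow> r \<noteq> \<infinity> \<Longrightarrow> 0 < enn2real r"
  by (cases r) auto

lemma le_lr_qnorm: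
  assumes "0 < r" "a \<in> A"
  shows "f a \<le> lr_qnorm r A f"
proof (cases "r = \<infinity>")
  case True
  with assms show ?thesis by (auto simp: lr_qnorm_def intro: SUP_upper)
next
  case False
  let ?r = "enn2real r"
  have r: "0 < ?r" using enn2real_pos assms False by blast
  have "ennpow (f a) ?r \<le> (\<integral>\<^sup>+ a. ennpow (f a) ?r \<partial>count_space A)"
    by (rule nn_integral_ge_point[OF assms(2), of "\<lambda>a. ennpow (f a) ?r"])
  then have "ennpow (ennpow (f a) ?r) (1 / ?r)
      \<le> ennpow (\<integral>\<^sup>+ a. ennpow (f a) ?r \<partial>count_space A) (1 / ?r)"
    using r by (intro ennpow_mono) auto
  then show ?thesis using False r by (simp add: lr_qnorm_def)
qed

text \<open>If \<open>c\<close> is nonzero, every selected \<open>a\<close> has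
  \<open>h a * \<theta>\<close> below the norm \<open>L\<close>, so the values
  \<open>h a powr p\<close> are geometric and bounded by \<open>(L / \<theta>) powr p\<close>; their
  sum is comparable to that bound. If \<open>q\<close> equals \<open>p\<close>, the comparison is
  termwise. The constant is chosen before \<open>K\<close>, \<open>h\<close>, \<open>g\<close> and
  \<open>\<theta>\<close>, so that the estimate can later be integrated over all points.\<close>

lemma pointwise_lower:
  fixes p c :: real and q :: ennreal
  assumes p: "0 < p" and q: "0 < q" and cq: "c \<noteq> 0 \<or> q = ennreal p"
  shows "\<exists>C>0. \<forall>K (l :: 'a \<Rightarrow> int) h g \<theta>. inj_on l K \<longrightarrow> 0 < \<theta> \<longrightarrow>
      (\<forall>a\<in>K. h a = 2 powr (c * of_int (l a)) \<and> 0 \<le> g a) \<longrightarrow>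
      (\<integral>\<^sup>+ a. ennreal (\<theta> powr p * h a powr p) \<partial>count_space {a\<in>K. \<theta> < g a})
        \<le> ennreal C * ennpow (lr_qnorm q K (\<lambda>a. ennreal (h a * g a))) p"
  using cq
proof
  assume c: "c \<noteq> 0"
  then have G: "0 < geom_const (c * p)" using p by (intro geom_const_pos) simp
  show ?thesis
  proof (intro exI[of _ "geom_const (c * p)"] conjI G allI impI)
    fix K and l :: "'a \<Rightarrow> int" and h g :: "'a \<Rightarrow> real" and \<theta> :: real
    assume inj: "inj_on l K" and \<theta>: "0 < \<theta>"
      and hg: "\<forall>a\<in>K. h a = 2 powr (c * of_int (l a)) \<and> 0 \<le> g a"
    define L where "L = lr_qnorm q K (\<lambda>a. ennreal (h a * g a))"
    have Lge: "ennreal (h a * g a) \<le> L" if "a \<in> K" for a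
      unfolding L_def by (rule le_lr_qnorm[OF q that, of "\<lambda>a. ennreal (h a * g a)"])
    show "(\<integral>\<^sup>+ a. ennreal (\<theta> powr p * h a powr p) \<partial>count_space {a\<in>K. \<theta> < g a})
        \<le> ennreal (geom_const (c * p)) * ennpow L p"
    proof (cases L)
      case (real y)
      have bnd: "h a * \<theta> \<le> y" if "a \<in> K" "\<theta> < g a" for a
      proof -
        have "h a * \<theta> \<le> h a * g a" using that hg by (intro mult_left_mono) auto
        also have "\<dots> \<le> y" using Lge[OF that(1)] real by simp
        finally show ?thesis .
      qed
      show ?thesis
      proof (cases "y = 0")
        case True
        have "{a\<in>K. \<theta> < g a} = {}"
          using bnd hg \<theta> True by (auto simp: mult_le_0_iff)
        then show ?thesis by (simp add: nn_integral_empty)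
      next
        case False
        with real have y: "0 < y" by simp
        have hp: "h a powr p = 2 powr (c * p * of_int (l a))" if "a \<in> K" for a
          using hg that by (simp add: powr_powr mult_ac)
        have le: "h a powr p \<le> (y / \<theta>) powr p" if "a \<in> K" "\<theta> < g a" for a
          using bnd[OF that] hg that \<theta> p by (intro powr_mono2) (auto simp: field_simps)
        have "(\<integral>\<^sup>+ a. ennreal (\<theta> powr p * h a powr p) \<partial>count_space {a\<in>K. \<theta> < g a})
          = (\<integral>\<^sup>+ a. ennreal (\<theta> powr p) * ennreal (2 powr (c * p * of_int (l a)))
               \<partial>count_space {a\<in>K. \<theta> < g a})"
          by (intro nn_integral_cong) (simp add: hp ennreal_mult)
        also have "\<dots> = ennreal (\<theta> powr p) *
            (\<integral>\<^sup>+ a. ennreal (2 powr (c * p * of_int (l a))) \<partial>count_space {a\<in>K. \<theta> < g a})"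
          by (rule nn_integral_cmult) simp
        also have "\<dots> \<le> ennreal (\<theta> powr p) * ennreal (geom_const (c * p) * (y / \<theta>) powr p)"
          using c p inj y \<theta> le
          by (intro mult_left_mono geometric_sum_le) (auto simp: hp intro: inj_on_subset)
        also have "\<dots> = ennreal (geom_const (c * p)) * ennpow L p"
          using \<theta> y G by (simp add: real powr_divide flip: ennreal_mult)
        finally show ?thesis .
      qed
    next
      case top
      with G show ?thesis by (simp add: ennreal_mult_top)
    qed
  qed
next
  assume q: "q = ennreal p"
  show ?thesis
  proof (intro exI[of _ 1] conjI allI impI)
    fix K and l :: "'a \<Rightarrow> int" and h g :: "'a \<Rightarrow> real" and \<theta> :: real
    assume \<theta>: "0 < \<theta>" and hg: "\<forall>a\<in>K. h a = 2 powr (c * of_int (l a)) \<and> 0 \<le> g a"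
    have "(\<integral>\<^sup>+ a. ennreal (\<theta> powr p * h a powr p) \<partial>count_space {a\<in>K. \<theta> < g a})
        \<le> (\<integral>\<^sup>+ a. ennpow (ennreal (h a * g a)) p \<partial>count_space {a\<in>K. \<theta> < g a})"
      using hg \<theta> p
      by (intro nn_integral_mono) (auto simp: powr_mult mult.commute intro!: ennreal_leI mult_left_mono powr_mono2)
    also have "\<dots> \<le> (\<integral>\<^sup>+ a. ennpow (ennreal (h a * g a)) p \<partial>count_space K)"
      by (rule nn_integral_count_space_mono_set) auto
    also have "\<dots> = ennreal 1 * ennpow (lr_qnorm q K (\<lambda>a. ennreal (h a * g a))) p"
      using p by (simp add: lr_qnorm_def q)
    finally show "(\<integral>\<^sup>+ a. ennreal (\<theta> powr p * h a powr p) \<partial>count_space {a\<in>K. \<theta> < g a})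
        \<le> ennreal 1 * ennpow (lr_qnorm q K (\<lambda>a. ennreal (h a * g a))) p" .
  qed simp
qed

text \<open>The bound \<open>g a \<le> \<theta>\<close> is used to give up a power
  \<open>\<epsilon>\<close> of \<open>g\<close>. A supremum is then bounded by the sum, and for
  \<open>q\<close> equal to \<open>p\<close> the estimate is termwise. For the remaining finite
  \<open>q\<close> two bounds on \<open>h a * g a\<close>, one increasing and one decreasing in
  \<open>h a\<close>, make both tails geometric.\<close>

lemma pointwise_upper:
  fixes p c \<epsilon> :: real and q :: ennreal
  assumes \<epsilon>: "0 < \<epsilon>" "\<epsilon> < p" and q: "0 < q" and cq: "c \<noteq> 0 \<or> q = ennreal p"
  shows "\<exists>C>0. \<forall>K (l :: 'a \<Rightarrow> int) h g \<theta>. inj_on l K \<longrightarrow> 0 < \<theta> \<longrightarrow>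
      (\<forall>a\<in>K. h a = 2 powr (c * of_int (l a)) \<and> 0 \<le> g a \<and> g a \<le> \<theta>) \<longrightarrow>
      ennpow (lr_qnorm q K (\<lambda>a. ennreal (h a * g a))) p
        \<le> ennreal C * (\<integral>\<^sup>+ a. ennreal (h a powr p * g a powr (p - \<epsilon>) * \<theta> powr \<epsilon>) \<partial>count_space K)"
proof -
  have p: "0 < p" using \<epsilon> by simp
  define r where "r = enn2real q"
  \<comment> \<open>The exponent of \<open>h a\<close> that appears, with a minus sign, when the
    bound on a single term of the right-hand sum is solved for \<open>h a * g a\<close> by a root of
    order \<open>p - \<epsilon>\<close>.\<close>
  define \<kappa> where "\<kappa> = \<epsilon> / (p - \<epsilon>)"
  have \<kappa>: "0 < \<kappa>" using \<epsilon> by (simp add: \<kappa>_def)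
  have pterm: "(x * y) powr p \<le> x powr p * y powr (p - \<epsilon>) * \<theta> powr \<epsilon>"
    if "0 \<le> x" "0 \<le> y" "y \<le> \<theta>" for x y \<theta> :: real
  proof -
    have "(x * y) powr p = x powr p * y powr (p - \<epsilon>) * y powr \<epsilon>"
      using that by (simp add: powr_mult mult.assoc flip: powr_add)
    also have "\<dots> \<le> x powr p * y powr (p - \<epsilon>) * \<theta> powr \<epsilon>"
      using that \<epsilon> by (intro mult_left_mono powr_mono2) auto
    finally show ?thesis .
  qed
  consider "q = \<infinity>" | "q = ennreal p" | "c \<noteq> 0" "q \<noteq> \<infinity>" using cq by blast
  then show ?thesis
  proof cases
    case 1
    show ?thesis
    proof (intro exI[of _ 1] conjI allI impI)
      fix K and l :: "'a \<Rightarrow> int" and h g :: "'a \<Rightarrow> real" and \<theta> :: real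
      assume hg: "\<forall>a\<in>K. h a = 2 powr (c * of_int (l a)) \<and> 0 \<le> g a \<and> g a \<le> \<theta>"
      let ?T = "\<lambda>a. ennreal (h a powr p * g a powr (p - \<epsilon>) * \<theta> powr \<epsilon>)"
      let ?S = "\<integral>\<^sup>+ a. ?T a \<partial>count_space K"
      have "ennreal (h a * g a) \<le> ennpow ?S (1 / p)" if "a \<in> K" for a
      proof -
        have "ennpow (ennreal (h a * g a)) p \<le> ?T a"
          using pterm[of "h a" "g a" \<theta>] hg that by (auto intro!: ennreal_leI)
        also have "\<dots> \<le> ?S"
          by (rule nn_integral_ge_point[OF that, of ?T])
        finally show ?thesis
          using p ennpow_mono[of "1/p" _ ?S] by fastforce
      qed
      then have "lr_qnorm q K (\<lambda>a. ennreal (h a * g a)) \<le> ennpow ?S (1 / p)"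
        by (auto simp: lr_qnorm_def 1 intro: SUP_least)
      from ennpow_mono[OF _ this, of p]
      show "ennpow (lr_qnorm q K (\<lambda>a. ennreal (h a * g a))) p \<le> ennreal 1 * ?S"
        using p by simp
    qed simp
  next
    case 2
    show ?thesis
    proof (intro exI[of _ 1] conjI allI impI)
      fix K and l :: "'a \<Rightarrow> int" and h g :: "'a \<Rightarrow> real" and \<theta> :: real
      assume hg: "\<forall>a\<in>K. h a = 2 powr (c * of_int (l a)) \<and> 0 \<le> g a \<and> g a \<le> \<theta>"
      have "ennpow (lr_qnorm q K (\<lambda>a. ennreal (h a * g a))) p
          = (\<integral>\<^sup>+ a. ennpow (ennreal (h a * g a)) p \<partial>count_space K)"
        using p by (simp add: lr_qnorm_def 2)
      also have "\<dots> \<le> (\<integral>\<^sup>+ a. ennreal (h a powr p * g a powr (p - \<epsilon>) * \<theta> powr \<epsilon>) \<partial>count_space K)"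
        using hg pterm by (intro nn_integral_mono) (auto intro!: ennreal_leI)
      finally show "ennpow (lr_qnorm q K (\<lambda>a. ennreal (h a * g a))) p
        \<le> ennreal 1 * (\<integral>\<^sup>+ a. ennreal (h a powr p * g a powr (p - \<epsilon>) * \<theta> powr \<epsilon>) \<partial>count_space K)"
        by simp
    qed simp
  next
    case 3
    have r: "0 < r" unfolding r_def using enn2real_pos q 3 by blast
    \<comment> \<open>One geometric constant for the indices below the crossing point and one for
      those above it.\<close>
    define G where "G = geom_const (c * r) + geom_const (- (c * \<kappa> * r))"
    have G1: "0 < geom_const (c * r)" "0 < geom_const (- (c * \<kappa> * r))"
      using 3 r \<kappa> by (auto intro!: geom_const_pos)
    then have G: "0 < G" by (simp add: G_def)
    show ?thesis
    proof (intro exI[of _ "G powr (p / r)"] conjI allI impI)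
      fix K and l :: "'a \<Rightarrow> int" and h g :: "'a \<Rightarrow> real" and \<theta> :: real
      assume inj: "inj_on l K" and \<theta>: "0 < \<theta>"
        and hg: "\<forall>a\<in>K. h a = 2 powr (c * of_int (l a)) \<and> 0 \<le> g a \<and> g a \<le> \<theta>"
      let ?T = "\<lambda>a. h a powr p * g a powr (p - \<epsilon>) * \<theta> powr \<epsilon>"
      define S where "S = (\<integral>\<^sup>+ a. ennreal (?T a) \<partial>count_space K)"
      have SgeT: "ennreal (?T a) \<le> S" if "a \<in> K" for a
        unfolding S_def by (rule nn_integral_ge_point[OF that, of "\<lambda>a. ennreal (?T a)"])
      have hpos: "0 < h a" if "a \<in> K" for a using hg that by simp
      show "ennpow (lr_qnorm q K (\<lambda>a. ennreal (h a * g a))) p \<le> ennreal (G powr (p / r)) * S"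
      proof (cases S)
        case (real s)
        have Tle: "?T a \<le> s" if "a \<in> K" for a
          using SgeT[OF that] real by simp
        show ?thesis
        proof (cases "s = 0")
          \<comment> \<open>A vanishing sum forces every \<open>g a\<close> to vanish, because
            \<open>h a\<close> and \<open>\<theta>\<close> are positive; this frees the main case to
            divide by powers of \<open>s\<close>.\<close>
          case True
          have "g a = 0" if "a \<in> K" for a
            using Tle[OF that] hpos[OF that] \<theta> True hg that
            by (auto simp: mult_le_0_iff zero_less_mult_iff not_le)
          then have "lr_qnorm q K (\<lambda>a. ennreal (h a * g a)) = lr_qnorm q K (\<lambda>_. 0)"
            by (intro lr_qnorm_cong) simp
          then show ?thesis by simp
        next
          case False
          with real have s: "0 < s" by simp
          define B where "B = s powr (1 / p)"
          have B: "0 < B" using s by (simp add: B_def)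
          define D where "D = B powr (1 + \<kappa>) * \<theta> powr (- \<kappa>)"
          have p\<epsilon>: "p * (1 / (p - \<epsilon>)) = 1 + \<kappa>" "\<epsilon> * (1 / (p - \<epsilon>)) = \<kappa>"
            using \<epsilon> by (auto simp: \<kappa>_def field_simps)
          \<comment> \<open>Each term is below both \<open>\<theta> * h\<close> and \<open>D * h powr (- \<kappa>)\<close>; these cross at \<open>h = B / \<theta>\<close> with common
            value \<open>B\<close>, so the sum over the geometric \<open>h\<close> is dominated by the terms near the crossing.\<close>
          have big: "h a * g a \<le> D * h a powr (- \<kappa>)" if a: "a \<in> K" for a
          proof -
            have h: "0 < h a" "0 \<le> g a" using hpos a hg by auto
            have "(h a * g a) powr (p - \<epsilon>) = ?T a * h a powr (- \<epsilon>) * \<theta> powr (- \<epsilon>)"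
              using h \<theta> by (simp add: powr_mult powr_diff powr_minus field_simps)
            also have "\<dots> \<le> s * h a powr (- \<epsilon>) * \<theta> powr (- \<epsilon>)"
              using Tle[OF a] by (intro mult_right_mono) auto
            also have "s = B powr p"
              using s p by (simp add: B_def powr_powr)
            finally have "((h a * g a) powr (p - \<epsilon>)) powr (1 / (p - \<epsilon>))
                \<le> (B powr p * h a powr (- \<epsilon>) * \<theta> powr (- \<epsilon>)) powr (1 / (p - \<epsilon>))"
              using \<epsilon> by (intro powr_mono2) auto
            also have "\<dots> = D * h a powr (- \<kappa>)"
              unfolding D_def powr_mult powr_powr p\<epsilon>(1) using p\<epsilon>(2) by (simp add: mult_ac)
            finally show ?thesis
              using h \<epsilon> by (simp add: powr_powr)
          qed
          have hr: "h a powr (x * r) = 2 powr (c * x * r * of_int (l a))" if "a \<in> K" for a x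
            using hg that by (simp add: powr_powr mult_ac)
          let ?K1 = "{a\<in>K. h a \<le> B / \<theta>}" and ?K2 = "{a\<in>K. h a > B / \<theta>}"
          have "(\<integral>\<^sup>+ a. ennpow (ennreal (h a * g a)) r \<partial>count_space K)
            \<le> (\<integral>\<^sup>+ a. (ennreal (\<theta> powr r) * ennreal (2 powr (c * r * of_int (l a)))) * indicator ?K1 a
               + (ennreal (D powr r) * ennreal (2 powr (- (c * \<kappa> * r) * of_int (l a)))) * indicator ?K2 a
               \<partial>count_space K)"
          proof (rule nn_integral_mono)
            fix a assume "a \<in> space (count_space K)"
            then have a: "a \<in> K" by simp
            have h: "0 < h a" "0 \<le> g a" "g a \<le> \<theta>" using hpos a hg by auto
            show "ennpow (ennreal (h a * g a)) r \<le>
               (ennreal (\<theta> powr r) * ennreal (2 powr (c * r * of_int (l a)))) * indicator ?K1 a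
               + (ennreal (D powr r) * ennreal (2 powr (- (c * \<kappa> * r) * of_int (l a)))) * indicator ?K2 a"
            proof (cases "h a \<le> B / \<theta>")
              case True
              have "(h a * g a) powr r \<le> (h a * \<theta>) powr r"
                using h r by (intro powr_mono2 mult_left_mono) auto
              also have "\<dots> = \<theta> powr r * 2 powr (c * r * of_int (l a))"
                using h \<theta> hr[OF a, of 1] by (simp add: powr_mult mult.commute)
              finally show ?thesis
                using True a h by (simp add: ennreal_leI flip: ennreal_mult)
            next
              case False
              have "(h a * g a) powr r \<le> (D * h a powr (- \<kappa>)) powr r"
                using h r big[OF a] by (intro powr_mono2) auto
              also have "\<dots> = D powr r * 2 powr (- (c * \<kappa> * r) * of_int (l a))"
                using h \<theta> hr[OF a, of "-\<kappa>"] by (simp add: powr_mult powr_powr D_def)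
              finally show ?thesis
                using False a h by (simp add: ennreal_leI flip: ennreal_mult)
            qed
          qed
          also have "\<dots> = (\<integral>\<^sup>+ a. ennreal (\<theta> powr r) * ennreal (2 powr (c * r * of_int (l a))) \<partial>count_space ?K1)
             + (\<integral>\<^sup>+ a. ennreal (D powr r) * ennreal (2 powr (- (c * \<kappa> * r) * of_int (l a))) \<partial>count_space ?K2)"
            by (subst nn_integral_add) (auto simp: nn_integral_count_space_indicator
                  intro!: arg_cong2[where f = plus] nn_integral_cong split: split_indicator)
          also have "\<dots> = ennreal (\<theta> powr r) * (\<integral>\<^sup>+ a. ennreal (2 powr (c * r * of_int (l a))) \<partial>count_space ?K1)
             + ennreal (D powr r) * (\<integral>\<^sup>+ a. ennreal (2 powr (- (c * \<kappa> * r) * of_int (l a))) \<partial>count_space ?K2)"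
            by (simp add: nn_integral_cmult)
          also have "\<dots> \<le> ennreal (\<theta> powr r) * ennreal (geom_const (c * r) * (B / \<theta>) powr r)
             + ennreal (D powr r) * ennreal (geom_const (- (c * \<kappa> * r)) * (B / \<theta>) powr (- \<kappa> * r))"
          proof (intro add_mono mult_left_mono geometric_sum_le)
            show "2 powr (c * r * of_int (l a)) \<le> (B / \<theta>) powr r" if "a \<in> ?K1" for a
              using that r hpos[of a] hr[of a 1] powr_mono2[of r "h a" "B / \<theta>"] by simp
            show "2 powr (- (c * \<kappa> * r) * of_int (l a)) \<le> (B / \<theta>) powr (- \<kappa> * r)" if "a \<in> ?K2" for a
              using that r \<kappa> B \<theta> hpos[of a] hr[of a "-\<kappa>"] powr_mono2'[of "- \<kappa> * r" "B / \<theta>" "h a"] by simp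
          qed (use 3 r \<kappa> B \<theta> inj in \<open>auto intro: inj_on_subset\<close>)
          also have "\<dots> = ennreal (G * B powr r)"
          proof -
            \<comment> \<open>Both halves scale like \<open>B powr r\<close>; in the second one
              \<open>D\<close> contributes the exponent \<open>1 + \<kappa>\<close> and the cut at
              \<open>B / \<theta>\<close> contributes \<open>- \<kappa>\<close>.\<close>
            have e1: "\<theta> powr r * (geom_const (c * r) * (B / \<theta>) powr r) = geom_const (c * r) * B powr r"
              using B \<theta> by (simp add: powr_divide)
            have "D powr r * (B / \<theta>) powr (- \<kappa> * r) = B powr ((1 + \<kappa>) * r) * B powr (- \<kappa> * r)"
              using \<theta> by (simp add: D_def powr_divide powr_mult powr_powr)
            also have "\<dots> = B powr r"
              by (simp add: ring_distribs flip: powr_add)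
            finally have e2: "D powr r * (geom_const (- (c * \<kappa> * r)) * (B / \<theta>) powr (- \<kappa> * r))
                = geom_const (- (c * \<kappa> * r)) * B powr r"
              by (metis mult.left_commute)
            have "ennreal x * ennreal (y * z) + ennreal x' * ennreal (y' * z') = ennreal (x * (y * z) + x' * (y' * z'))"
              if "0 \<le> x" "0 \<le> y" "0 \<le> z" "0 \<le> x'" "0 \<le> y'" "0 \<le> z'" for x y z x' y' z' :: real
              using that by (simp flip: ennreal_mult ennreal_plus)
            then show ?thesis
              unfolding G_def distrib_right e1[symmetric] e2[symmetric] using G1 by simp
          qed
          finally have le: "(\<integral>\<^sup>+ a. ennpow (ennreal (h a * g a)) r \<partial>count_space K) \<le> ennreal (G * B powr r)" .
          have "ennpow (lr_qnorm q K (\<lambda>a. ennreal (h a * g a))) p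
              = ennpow (\<integral>\<^sup>+ a. ennpow (ennreal (h a * g a)) r \<partial>count_space K) (p / r)"
            using 3 by (simp add: lr_qnorm_def r_def)
          also have "\<dots> \<le> ennpow (ennreal (G * B powr r)) (p / r)"
            using p r le by (intro ennpow_mono) auto
          also have "\<dots> = ennreal (G powr (p / r)) * S"
            using G B s p r by (simp add: real powr_mult powr_powr B_def flip: ennreal_mult)
          finally show ?thesis .
        qed
      next
        case top
        with G show ?thesis by (simp add: ennreal_mult_top)
      qed
    qed (use G in simp)
  qed
qed

section \<open>Direct and inverse estimates over a measure space\<close>

lemma borel_measurable_count_space_sum [measurable]:
  fixes f :: "'i \<Rightarrow> 'a \<Rightarrow> ennreal"
  assumes "countable I" and [measurable]: "\<And>i. i \<in> I \<Longrightarrow> f i \<in> borel_measurable M"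
  shows "(\<lambda>x. \<integral>\<^sup>+ i. f i x \<partial>count_space I) \<in> borel_measurable M"
proof (cases "I = {}")
  case True
  then show ?thesis by (simp add: nn_integral_empty)
next
  case False
  have "(\<integral>\<^sup>+ i. f i x \<partial>count_space I)
      = (\<Sum>n. f (from_nat_into I n) x * indicator (to_nat_on I ` I) n)" for x
  proof -
    have "(\<integral>\<^sup>+ i. f i x \<partial>count_space I)
        = (\<integral>\<^sup>+ i. f (from_nat_into I (to_nat_on I i)) x \<partial>count_space I)"
      using assms(1) by (intro nn_integral_cong) simp
    also have "\<dots> = (\<integral>\<^sup>+ n. f (from_nat_into I n) x \<partial>count_space (to_nat_on I ` I))"
      using assms(1) by (intro nn_integral_bij_count_space) (auto simp: bij_betw_def inj_on_to_nat_on)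
    finally show ?thesis
      by (simp add: nn_integral_count_space_indicator flip: nn_integral_count_space_nat)
  qed
  moreover have "f (from_nat_into I n) \<in> borel_measurable M" for n
    using False by (intro assms(2) from_nat_into)
  ultimately show ?thesis by (simp add: borel_measurable_suminf)
qed

text \<open>No measurability of \<open>F\<close> is available where this is applied.\<close>

lemma nn_integral_le_cmult:
  assumes f: "f \<in> borel_measurable M" and c: "0 < c"
    and le: "\<And>x. x \<in> space M \<Longrightarrow> f x \<le> ennreal c * F x"
  shows "(\<integral>\<^sup>+ x. f x \<partial>M) \<le> ennreal c * (\<integral>\<^sup>+ x. F x \<partial>M)"
proof -
  \<comment> \<open>Pulling a constant out of an integral requires a measurable integrand, so it is
    inserted and extracted on the side of \<open>f\<close>; afterwards only monotonicity is applied
    to \<open>F\<close>.\<close>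
  have cc: "ennreal c * ennreal (1 / c) = 1"
    using c by (simp flip: ennreal_mult)
  have "(\<integral>\<^sup>+ x. f x \<partial>M) = (\<integral>\<^sup>+ x. ennreal c * (ennreal (1 / c) * f x) \<partial>M)"
    by (simp add: cc flip: mult.assoc)
  also have "\<dots> = ennreal c * (\<integral>\<^sup>+ x. ennreal (1 / c) * f x \<partial>M)"
    using f by (intro nn_integral_cmult) auto
  also have "\<dots> \<le> ennreal c * (\<integral>\<^sup>+ x. F x \<partial>M)"
  proof (intro mult_left_mono nn_integral_mono)
    fix x assume "x \<in> space M"
    then have "ennreal (1 / c) * f x \<le> ennreal (1 / c) * (ennreal c * F x)"
      by (intro mult_left_mono le) auto
    also have "\<dots> = F x" using cc by (simp add: mult.assoc[symmetric] mult.commute)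
    finally show "ennreal (1 / c) * f x \<le> F x" .
  qed simp
  finally show ?thesis .
qed

text \<open>A crude form of Young's inequality: once both arguments are replaced by their maximum,
  the exponents add up to 1.\<close>

lemma ennpow_Young:
  assumes "0 < \<eta>" "\<eta> < 1"
  shows "ennpow a (1 - \<eta>) * ennpow b \<eta> \<le> a + b"
proof -
  have eq: "ennpow m (1 - \<eta>) * ennpow m \<eta> = m" for m
    using assms by (cases m) (auto simp: ennreal_top_mult simp flip: ennreal_mult powr_add)
  have "ennpow a (1 - \<eta>) * ennpow b \<eta> \<le> ennpow (max a b) (1 - \<eta>) * ennpow (max a b) \<eta>"
    using assms by (intro mult_mono ennpow_mono) auto
  also have "\<dots> = max a b" by (rule eq)
  also have "\<dots> \<le> a + b" by (simp add: add_increasing add_increasing2)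
  finally show ?thesis .
qed

lemma emeasure_lborel_greaterThan: "emeasure lborel {a::real<..} = top"
proof (rule ccontr)
  assume "emeasure lborel {a<..} \<noteq> top"
  then obtain r where r: "emeasure lborel {a<..} = ennreal r" "0 \<le> r"
    by (cases "emeasure lborel {a<..}") auto
  have "emeasure lborel {a<..<a + (r + 1)} \<le> emeasure lborel {a<..}"
    by (intro emeasure_mono) auto
  with r show False by simp
qed

text \<open>This is the integral of \<open>t powr (- \<eta>)\<close> from 0 to \<open>y\<close>,
  finite near 0 because \<open>\<eta> < 1\<close>. The endpoint is allowed to be infinite since it
  will be the measure of a superlevel set.\<close>

lemma nn_integral_powr_less:
  assumes "0 < \<eta>" "\<eta> < 1"
  shows "(\<integral>\<^sup>+ t. ennreal (t powr (- \<eta>)) * indicator {t. 0 < t \<and> ennreal t < y} t \<partial>lborel)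
    \<le> ennreal (1 / (1 - \<eta>)) * ennpow y (1 - \<eta>)"
proof (cases y)
  case (real c)
  have "(\<integral>\<^sup>+ t. ennreal (t powr (- \<eta>)) * indicator {t. 0 < t \<and> ennreal t < y} t \<partial>lborel)
    \<le> (\<integral>\<^sup>+ t. ennreal (indicator {0..c} t * t powr (- \<eta>)) \<partial>lborel)"
    using real by (intro nn_integral_mono) (auto simp: indicator_def ennreal_less_iff)
  also have "\<dots> = ennreal (c powr (- \<eta> + 1) / (- \<eta> + 1))"
    using assms real
    by (intro nn_integral_has_integral_lebesgue has_integral_powr_from_0) auto
  also have "\<dots> = ennreal (1 / (1 - \<eta>)) * ennpow y (1 - \<eta>)"
    using assms real by (simp add: mult.commute flip: ennreal_mult)
  finally show ?thesis .
next
  case top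
  with assms show ?thesis by (simp add: ennreal_mult_top)
qed

lemma dyadic_level_sum_le:
  assumes "c \<noteq> 0" "0 < y"
  shows "(\<integral>\<^sup>+ k. ennreal (2 powr (c * of_int k)) * indicator {k. 2 powr (c * of_int k) \<le> y} k
      \<partial>count_space (UNIV :: int set)) \<le> ennreal (geom_const c * y)"
  using geometric_sum_le[OF assms(1) _ assms(2), of id "{k. 2 powr (c * of_int k) \<le> y}"]
  by (simp add: nn_integral_count_space_indicator)

text \<open>For each \<open>t\<close> a threshold 2^k is chosen at which the superlevel set first
  fits into the budget \<open>t\<close>. Integrating \<open>t powr (- \<eta>)\<close> over the
  values \<open>t\<close> that can lead to a given \<open>k\<close> produces
  \<open>ennpow (N (L (k - 1))) (1 - \<eta>)\<close>, and Young's inequality separates this measure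
  from the error bound \<open>X k\<close>. Both resulting sums over \<open>k\<close> are geometric
  after exchange with the integral. The error \<open>\<sigma>\<close> is an arbitrary function here,
  with no measurability assumed.\<close>

lemma jackson_estimate:
  fixes g :: "'a \<Rightarrow> real" and \<sigma> :: "real \<Rightarrow> ennreal"
  assumes \<tau>: "0 < \<tau>" and \<epsilon>: "0 < \<epsilon>" "\<epsilon> < p - \<tau>" and C: "0 < C"
    and g [measurable]: "g \<in> borel_measurable M" and g0: "\<And>x. 0 \<le> g x"
    and \<sigma>: "\<And>t \<theta>. 0 < t \<Longrightarrow> 0 < \<theta> \<Longrightarrow> emeasure M {x \<in> space M. \<theta> < g x} \<le> ennreal t \<Longrightarrow>
       ennpow (\<sigma> t) p \<le> ennreal C *
         (\<integral>\<^sup>+ x. ennreal (g x powr (p - \<epsilon>) * \<theta> powr \<epsilon>) * indicator {x. g x \<le> \<theta>} x \<partial>M)"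
    and \<sigma>_0: "\<And>t. 0 < t \<Longrightarrow> emeasure M {x \<in> space M. 0 < g x} \<le> ennreal t \<Longrightarrow> \<sigma> t = 0"
  shows "(\<integral>\<^sup>+ t. ennreal (t powr (- (\<tau> / p))) * ennpow (\<sigma> t) \<tau> * indicator {0<..} t \<partial>lborel)
    \<le> ennreal ((geom_const \<tau> * 2 powr \<tau> + C * geom_const (- (p - \<tau> - \<epsilon>))) / (1 - \<tau> / p))
        * (\<integral>\<^sup>+ x. ennreal (g x powr \<tau>) \<partial>M)"
proof -
  define \<eta> where "\<eta> = \<tau> / p"
  have \<eta>: "0 < \<eta>" "\<eta> < 1" using \<tau> \<epsilon> by (auto simp: \<eta>_def)
  have p: "0 < p" using \<tau> \<epsilon> by simp
  define N where "N \<theta> = emeasure M {x \<in> space M. \<theta> < g x}" for \<theta>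
  define I where "I = (\<integral>\<^sup>+ x. ennreal (g x powr \<tau>) \<partial>M)"
  define L where "L k = (2::real) powr (of_int k)" for k :: int
  define X where "X k = ennreal C *
      (\<integral>\<^sup>+ x. ennreal (g x powr (p - \<epsilon>) * L k powr \<epsilon>) * indicator {x. g x \<le> L k} x \<partial>M)" for k
  have L: "0 < L k" for k by (simp add: L_def)
  have L_powr: "L k powr a = 2 powr (a * of_int k)" for k a
    by (simp add: L_def powr_powr mult.commute)
  have L_pred: "L (k - 1) = L k / 2" for k by (simp add: L_def powr_diff)
  have N_antimono: "N b \<le> N a" if "a \<le> b" for a b
    unfolding N_def using that by (intro emeasure_mono) auto
  have G1: "0 < geom_const \<tau>" "0 < geom_const (- (p - \<tau> - \<epsilon>))"
    using \<tau> \<epsilon> by (auto intro!: geom_const_pos)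
  define G where "G = geom_const \<tau> * 2 powr \<tau> + C * geom_const (- (p - \<tau> - \<epsilon>))"
  have G: "0 < G" using G1 C by (simp add: G_def add_pos_pos)
  \<comment> \<open>The scaling by powers of 2 is chosen so that both right-hand sums over \<open>k\<close> become geometric.\<close>
  have young: "ennpow (N (L (k - 1))) (1 - \<eta>) * ennpow (X k) \<eta>
      \<le> ennreal (2 powr (\<tau> * of_int k)) * N (L (k - 1)) + ennreal (2 powr (- (p - \<tau>) * of_int k)) * X k" for k
  proof -
    have "\<tau> * of_int k * (1 - \<eta>) + - (p - \<tau>) * of_int k * \<eta> = 0"
      using p by (simp add: \<eta>_def field_simps)
    then have one: "ennreal (2 powr (\<tau> * of_int k * (1 - \<eta>))) * ennreal (2 powr (- (p - \<tau>) * of_int k * \<eta>)) = 1"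
      by (simp flip: ennreal_mult powr_add)
    have scaled: "ennpow (ennreal (2 powr x) * y) a = ennreal (2 powr (x * a)) * ennpow y a" for x y a
      by (simp add: ennpow_mult powr_powr)
    have "ennpow (ennreal (2 powr (\<tau> * of_int k)) * N (L (k - 1))) (1 - \<eta>)
        * ennpow (ennreal (2 powr (- (p - \<tau>) * of_int k)) * X k) \<eta>
      = (ennreal (2 powr (\<tau> * of_int k * (1 - \<eta>))) * ennreal (2 powr (- (p - \<tau>) * of_int k * \<eta>)))
        * (ennpow (N (L (k - 1))) (1 - \<eta>) * ennpow (X k) \<eta>)"
      unfolding scaled by (simp only: mult_ac)
    with one show ?thesis using ennpow_Young[OF \<eta>] by (metis mult_1)
  qed
  \<comment> \<open>After the exchange, the terms at \<open>x\<close> have 2^k below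
    \<open>2 * g x\<close>, so the largest of them dominates; the shift from \<open>k\<close> to
    \<open>k - 1\<close> costs the factor \<open>2 powr \<tau>\<close>.\<close>
  have sum1: "(\<integral>\<^sup>+ k. ennreal (2 powr (\<tau> * of_int k)) * N (L (k - 1)) \<partial>count_space UNIV)
      \<le> ennreal (geom_const \<tau> * 2 powr \<tau>) * I"
  proof -
    have "(\<integral>\<^sup>+ k. ennreal (2 powr (\<tau> * of_int k)) * N (L (k - 1)) \<partial>count_space UNIV)
      = (\<integral>\<^sup>+ k. (\<integral>\<^sup>+ x. ennreal (2 powr (\<tau> * of_int k)) * indicator {x\<in>space M. L (k - 1) < g x} x \<partial>M) \<partial>count_space UNIV)"
      unfolding N_def by (intro nn_integral_cong, subst nn_integral_cmult_indicator) auto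
    also have "\<dots> = (\<integral>\<^sup>+ x. (\<integral>\<^sup>+ k. ennreal (2 powr (\<tau> * of_int k)) * indicator {x\<in>space M. L (k - 1) < g x} x \<partial>count_space UNIV) \<partial>M)"
      by (rule nn_integral_count_space_nn_integral[symmetric]) auto
    also have "\<dots> \<le> (\<integral>\<^sup>+ x. ennreal (geom_const \<tau> * 2 powr \<tau>) * ennreal (g x powr \<tau>) \<partial>M)"
    proof (rule nn_integral_mono)
      fix x
      show "(\<integral>\<^sup>+ k. ennreal (2 powr (\<tau> * of_int k)) * indicator {x\<in>space M. L (k - 1) < g x} x \<partial>count_space UNIV)
          \<le> ennreal (geom_const \<tau> * 2 powr \<tau>) * ennreal (g x powr \<tau>)"
      proof (cases "g x = 0")
        case True
        then have "\<not> L (k - 1) < g x" for k using L[of "k - 1"] by simp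
        then show ?thesis by simp
      next
        case False
        with g0[of x] have gx: "0 < g x" by simp
        have "2 powr (\<tau> * of_int k) \<le> (2 * g x) powr \<tau>" if "L (k - 1) < g x" for k
          using that \<tau> L[of k] L_powr[of k \<tau>] powr_mono2[of \<tau> "L k" "2 * g x"] by (simp add: L_pred)
        then have "(\<integral>\<^sup>+ k. ennreal (2 powr (\<tau> * of_int k)) * indicator {x\<in>space M. L (k - 1) < g x} x \<partial>count_space UNIV)
          \<le> (\<integral>\<^sup>+ k. ennreal (2 powr (\<tau> * of_int k)) * indicator {k. 2 powr (\<tau> * of_int k) \<le> (2 * g x) powr \<tau>} k \<partial>count_space UNIV)"
          by (intro nn_integral_mono) (auto simp: indicator_def)
        also have "\<dots> \<le> ennreal (geom_const \<tau> * (2 * g x) powr \<tau>)"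
          using \<tau> gx by (intro dyadic_level_sum_le) auto
        finally show ?thesis
          using gx G1 by (simp add: powr_mult mult.assoc flip: ennreal_mult)
      qed
    qed
    also have "\<dots> = ennreal (geom_const \<tau> * 2 powr \<tau>) * I"
      unfolding I_def by (intro nn_integral_cmult) auto
    finally show ?thesis .
  qed
  \<comment> \<open>Here the levels at \<open>x\<close> satisfy \<open>g x \<le> L k\<close> and the
    weights decay like \<open>2 powr (- (p - \<tau> - \<epsilon>) * k)\<close>. The condition
    \<open>\<epsilon> < p - \<tau>\<close> makes this a true decay, and the lowest level yields
    \<open>g x powr \<tau>\<close>.\<close>
  have sum2: "(\<integral>\<^sup>+ k. ennreal (2 powr (- (p - \<tau>) * of_int k)) * X k \<partial>count_space UNIV)
      \<le> ennreal (C * geom_const (- (p - \<tau> - \<epsilon>))) * I"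
  proof -
    let ?c = "- (p - \<tau> - \<epsilon>)"
    have "(\<integral>\<^sup>+ k. ennreal (2 powr (- (p - \<tau>) * of_int k)) * X k \<partial>count_space UNIV)
      = (\<integral>\<^sup>+ k. (\<integral>\<^sup>+ x. ennreal C * ennreal (g x powr (p - \<epsilon>)) * (ennreal (2 powr (?c * of_int k)) * indicator {x. g x \<le> L k} x) \<partial>M) \<partial>count_space UNIV)"
    proof (rule nn_integral_cong)
      fix k
      have "2 powr (- (p - \<tau>) * of_int k) * L k powr \<epsilon> = 2 powr (?c * of_int k)"
        by (simp add: L_powr algebra_simps flip: powr_add)
      then have eq: "ennreal (2 powr (- (p - \<tau>) * of_int k)) * (ennreal C * ennreal (g x powr (p - \<epsilon>) * L k powr \<epsilon>))
          = ennreal C * ennreal (g x powr (p - \<epsilon>)) * ennreal (2 powr (?c * of_int k))" for x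
        using C by (simp add: mult_ac flip: ennreal_mult)
      have "ennreal (2 powr (- (p - \<tau>) * of_int k)) * X k
        = (\<integral>\<^sup>+ x. ennreal (2 powr (- (p - \<tau>) * of_int k)) * (ennreal C *
            (ennreal (g x powr (p - \<epsilon>) * L k powr \<epsilon>) * indicator {x. g x \<le> L k} x)) \<partial>M)"
        unfolding X_def by (simp add: nn_integral_cmult)
      also have "\<dots> = (\<integral>\<^sup>+ x. ennreal C * ennreal (g x powr (p - \<epsilon>)) * (ennreal (2 powr (?c * of_int k)) * indicator {x. g x \<le> L k} x) \<partial>M)"
        using eq by (simp add: mult.assoc[symmetric])
      finally show "ennreal (2 powr (- (p - \<tau>) * of_int k)) * X k = \<dots>" .
    qed
    also have "\<dots> = (\<integral>\<^sup>+ x. (\<integral>\<^sup>+ k. ennreal C * ennreal (g x powr (p - \<epsilon>)) * (ennreal (2 powr (?c * of_int k)) * indicator {x. g x \<le> L k} x) \<partial>count_space UNIV) \<partial>M)"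
      by (rule nn_integral_count_space_nn_integral[symmetric]) auto
    also have "\<dots> \<le> (\<integral>\<^sup>+ x. ennreal (C * geom_const ?c) * ennreal (g x powr \<tau>) \<partial>M)"
    proof (rule nn_integral_mono)
      fix x
      show "(\<integral>\<^sup>+ k. ennreal C * ennreal (g x powr (p - \<epsilon>)) * (ennreal (2 powr (?c * of_int k)) * indicator {x. g x \<le> L k} x) \<partial>count_space UNIV)
          \<le> ennreal (C * geom_const ?c) * ennreal (g x powr \<tau>)"
      proof (cases "g x = 0")
        case True
        then show ?thesis by simp
      next
        case False
        with g0[of x] have gx: "0 < g x" by simp
        have "2 powr (?c * of_int k) \<le> g x powr ?c" if "g x \<le> L k" for k
          using that \<epsilon> gx L_powr[of k ?c] powr_mono2'[of ?c "g x" "L k"] by simp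
        then have "(\<integral>\<^sup>+ k. ennreal (2 powr (?c * of_int k)) * indicator {x. g x \<le> L k} x \<partial>count_space UNIV)
          \<le> (\<integral>\<^sup>+ k. ennreal (2 powr (?c * of_int k)) * indicator {k. 2 powr (?c * of_int k) \<le> g x powr ?c} k \<partial>count_space UNIV)"
          by (intro nn_integral_mono) (auto simp: indicator_def)
        also have "\<dots> \<le> ennreal (geom_const ?c * g x powr ?c)"
          using \<epsilon> gx by (intro dyadic_level_sum_le) auto
        finally have "ennreal C * ennreal (g x powr (p - \<epsilon>)) * (\<integral>\<^sup>+ k. ennreal (2 powr (?c * of_int k)) * indicator {x. g x \<le> L k} x \<partial>count_space UNIV)
          \<le> ennreal C * ennreal (g x powr (p - \<epsilon>)) * ennreal (geom_const ?c * g x powr ?c)"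
          by (intro mult_left_mono) auto
        also have "\<dots> = ennreal (C * geom_const ?c) * ennreal (g x powr \<tau>)"
        proof -
          have "g x powr (p - \<epsilon>) * g x powr ?c = g x powr \<tau>"
            by (simp flip: powr_add)
          then show ?thesis using G1 C by (simp add: mult_ac flip: ennreal_mult)
        qed
        finally show ?thesis by (simp add: nn_integral_cmult)
      qed
    qed
    also have "\<dots> = ennreal (C * geom_const ?c) * I"
      unfolding I_def by (intro nn_integral_cmult) auto
    finally show ?thesis .
  qed
  show ?thesis
  proof (cases "I = top")
    case True
    then show ?thesis
      unfolding I_def[symmetric] G_def[symmetric] \<eta>_def[symmetric] using G \<eta> by (simp add: ennreal_mult_top)
  next
    case False
    \<comment> \<open>Chebyshev's inequality for \<open>g powr \<tau>\<close>. The summand 1 keeps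
      the argument of the logarithm positive when the integral is 0.\<close>
    have ex_small: "\<exists>k. N (L k) \<le> ennreal t" if t: "0 < t" for t
    proof -
      obtain i where i: "I = ennreal i" "0 \<le> i" using False by (cases I) auto
      define k where "k = \<lceil>log 2 (i / t + 1) / \<tau>\<rceil>"
      have "log 2 (i / t + 1) / \<tau> \<le> of_int k" by (simp add: k_def)
      then have "log 2 (i / t + 1) \<le> \<tau> * of_int k"
        using \<tau> by (simp add: pos_divide_le_eq mult.commute)
      then have "i / t + 1 \<le> L k powr \<tau>"
        using i t by (simp add: L_powr log_le_iff add_nonneg_pos)
      then have le: "i \<le> L k powr \<tau> * t"
        using t by (simp add: field_simps)
      have "ennreal (L k powr \<tau>) * N (L k) = (\<integral>\<^sup>+ x. ennreal (L k powr \<tau>) * indicator {x\<in>space M. L k < g x} x \<partial>M)"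
        unfolding N_def by (subst nn_integral_cmult_indicator) auto
      also have "\<dots> \<le> I" unfolding I_def
        using L[of k] \<tau> by (intro nn_integral_mono) (auto simp: indicator_def intro!: ennreal_leI powr_mono2)
      also have "\<dots> \<le> ennreal (L k powr \<tau>) * ennreal t"
        unfolding i using le t by (simp add: ennreal_leI flip: ennreal_mult)
      finally have "N (L k) \<le> ennreal t"
        using L[of k] by (subst (asm) ennreal_mult_le_mult_iff) auto
      then show ?thesis by blast
    qed
    \<comment> \<open>Continuity from below as \<open>k\<close> tends to minus infinity. If every
      dyadic superlevel set fits into \<open>t\<close>, then so does the whole support of
      \<open>g\<close>, and \<open>\<sigma>_0\<close> takes care of such \<open>t\<close>.\<close>
    have N_0: "N 0 \<le> ennreal t" if "\<And>k. N (L k) \<le> ennreal t" for t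
    proof -
      let ?A = "\<lambda>n. {x \<in> space M. L (- int n) < g x}"
      have "(\<Union>n. ?A n) = {x \<in> space M. 0 < g x}"
      proof safe
        fix x n assume "L (- int n) < g x"
        then show "0 < g x" using L[of "- int n"] by simp
      next
        fix x assume x: "x \<in> space M" "0 < g x"
        obtain n where "(1/2) ^ n < g x" using real_arch_pow_inv[OF x(2), of "1/2"] by auto
        moreover have "L (- int n) = (1/2) ^ n"
          by (simp add: L_def powr_minus powr_realpow power_one_over inverse_eq_divide)
        ultimately show "x \<in> (\<Union>n. ?A n)" using x by (auto intro!: exI[of _ n])
      qed
      moreover have "incseq ?A"
      proof (intro monoI subsetI)
        fix m n :: nat and x assume "m \<le> n" and x: "x \<in> ?A m"
        then have "L (- int n) \<le> L (- int m)" by (simp add: L_def)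
        with x show "x \<in> ?A n" by auto
      qed
      then have "(SUP n. emeasure M (?A n)) = emeasure M (\<Union>n. ?A n)"
        by (intro SUP_emeasure_incseq) auto
      ultimately have "N 0 = (SUP n. N (L (- int n)))" by (simp add: N_def)
      then show ?thesis using that by (auto intro: SUP_least)
    qed
    \<comment> \<open>A sum over all \<open>k\<close> stands in for the single selected one, so the
      choice of \<open>k\<close> need not be measurable in \<open>t\<close>.\<close>
    have pointwise: "ennreal (t powr (- \<eta>)) * ennpow (\<sigma> t) \<tau> * indicator {0<..} t
      \<le> (\<integral>\<^sup>+ k. (ennreal (t powr (- \<eta>)) * indicator {t. 0 < t \<and> ennreal t < N (L (k - 1))} t) * ennpow (X k) \<eta> \<partial>count_space UNIV)"
      (is "_ \<le> (\<integral>\<^sup>+ k. ?F k \<partial>count_space UNIV)") for t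
    proof (cases "0 < t")
      case t: True
      show ?thesis
      proof (cases "\<forall>k. N (L k) \<le> ennreal t")
        case True
        then have "\<sigma> t = 0" using \<sigma>_0[OF t] N_0 by (simp add: N_def)
        then show ?thesis by simp
      next
        case False
        then obtain k1 where k1: "\<not> N (L k1) \<le> ennreal t" by blast
        obtain k0 where k0: "N (L k0) \<le> ennreal t" using ex_small[OF t] by blast
        have "k1 \<le> k0"
        proof (rule ccontr)
          assume "\<not> k1 \<le> k0"
          then have "N (L k1) \<le> N (L k0)" by (intro N_antimono) (simp add: L_def)
          with k0 k1 show False by simp
        qed
        then have "\<exists>n. N (L (k1 + int n)) \<le> ennreal t"
          using k0 by (intro exI[of _ "nat (k0 - k1)"]) simp
        moreover have "\<not> N (L (k1 + int 0)) \<le> ennreal t" using k1 by simp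
        \<comment> \<open>Climbing from a level that exceeds the budget, one meets a first level
          that fits; its predecessor still exceeds \<open>t\<close>, which puts \<open>t\<close> in
          the range of integration for that \<open>k\<close>.\<close>
        ultimately obtain n where n: "\<not> N (L (k1 + int n)) \<le> ennreal t" "N (L (k1 + int (Suc n))) \<le> ennreal t"
          using exists_least_lemma[of "\<lambda>n. N (L (k1 + int n)) \<le> ennreal t"] by blast
        define k where "k = k1 + int (Suc n)"
        have k: "N (L k) \<le> ennreal t" "ennreal t < N (L (k - 1))"
          using n by (auto simp: k_def not_le)
        have "ennpow (\<sigma> t) p \<le> X k"
          unfolding X_def using k(1) by (intro \<sigma> t L) (simp add: N_def)
        then have "ennpow (ennpow (\<sigma> t) p) \<eta> \<le> ennpow (X k) \<eta>"
          using \<eta> by (intro ennpow_mono) auto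
        then have "ennpow (\<sigma> t) \<tau> \<le> ennpow (X k) \<eta>"
          using p by (simp add: \<eta>_def)
        then have "ennreal (t powr (- \<eta>)) * ennpow (\<sigma> t) \<tau> * indicator {0<..} t \<le> ?F k"
          using t k by (simp add: mult_left_mono)
        also have "\<dots> \<le> (\<integral>\<^sup>+ k. ?F k \<partial>count_space UNIV)"
          by (rule nn_integral_ge_point) simp
        finally show ?thesis .
      qed
    qed simp
    have [measurable]: "{t. 0 < t \<and> ennreal t < y} \<in> sets borel" for y
      by measurable
    have "(\<integral>\<^sup>+ t. ennreal (t powr (- \<eta>)) * ennpow (\<sigma> t) \<tau> * indicator {0<..} t \<partial>lborel)
      \<le> (\<integral>\<^sup>+ t. (\<integral>\<^sup>+ k. (ennreal (t powr (- \<eta>)) * indicator {t. 0 < t \<and> ennreal t < N (L (k - 1))} t) * ennpow (X k) \<eta> \<partial>count_space UNIV) \<partial>lborel)"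
      by (intro nn_integral_mono pointwise)
    also have "\<dots> = (\<integral>\<^sup>+ k. (\<integral>\<^sup>+ t. (ennreal (t powr (- \<eta>)) * indicator {t. 0 < t \<and> ennreal t < N (L (k - 1))} t) * ennpow (X k) \<eta> \<partial>lborel) \<partial>count_space UNIV)"
      by (rule nn_integral_count_space_nn_integral) auto
    also have "\<dots> \<le> (\<integral>\<^sup>+ k. ennreal (1 / (1 - \<eta>)) * (ennreal (2 powr (\<tau> * of_int k)) * N (L (k - 1)) + ennreal (2 powr (- (p - \<tau>) * of_int k)) * X k) \<partial>count_space UNIV)"
    proof (rule nn_integral_mono)
      fix k
      have "(\<integral>\<^sup>+ t. (ennreal (t powr (- \<eta>)) * indicator {t. 0 < t \<and> ennreal t < N (L (k - 1))} t) * ennpow (X k) \<eta> \<partial>lborel)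
        \<le> (ennreal (1 / (1 - \<eta>)) * ennpow (N (L (k - 1))) (1 - \<eta>)) * ennpow (X k) \<eta>"
        using nn_integral_powr_less[OF \<eta>, of "N (L (k - 1))"]
        by (subst nn_integral_multc) (auto intro: mult_right_mono)
      also have "\<dots> \<le> ennreal (1 / (1 - \<eta>)) * (ennreal (2 powr (\<tau> * of_int k)) * N (L (k - 1)) + ennreal (2 powr (- (p - \<tau>) * of_int k)) * X k)"
        unfolding mult.assoc by (intro mult_left_mono young) auto
      finally show "(\<integral>\<^sup>+ t. (ennreal (t powr (- \<eta>)) * indicator {t. 0 < t \<and> ennreal t < N (L (k - 1))} t) * ennpow (X k) \<eta> \<partial>lborel)
         \<le> \<dots>" .
    qed
    also have "\<dots> = ennreal (1 / (1 - \<eta>)) * ((\<integral>\<^sup>+ k. ennreal (2 powr (\<tau> * of_int k)) * N (L (k - 1)) \<partial>count_space UNIV)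
         + (\<integral>\<^sup>+ k. ennreal (2 powr (- (p - \<tau>) * of_int k)) * X k \<partial>count_space UNIV))"
      by (simp add: nn_integral_cmult nn_integral_add)
    also have "\<dots> \<le> ennreal (1 / (1 - \<eta>)) * (ennreal (geom_const \<tau> * 2 powr \<tau>) * I + ennreal (C * geom_const (- (p - \<tau> - \<epsilon>))) * I)"
      by (intro mult_left_mono add_mono sum1 sum2) auto
    also have "ennreal (geom_const \<tau> * 2 powr \<tau>) * I + ennreal (C * geom_const (- (p - \<tau> - \<epsilon>))) * I = ennreal G * I"
      unfolding G_def using G1 C by (subst ennreal_plus) (auto simp: distrib_right)
    also have "ennreal (1 / (1 - \<eta>)) * (ennreal G * I) = ennreal (G / (1 - \<eta>)) * I"
      using \<eta> G by (simp flip: mult.assoc ennreal_mult)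
    finally show ?thesis unfolding G_def \<eta>_def I_def .
  qed
qed

text \<open>If the superlevel set at 2^k has measure above \<open>2 * t\<close>, the budget
  \<open>t\<close> accounts for less than half of it, so the error at \<open>t\<close> must be at
  least of order \<open>2^k * t powr (1 / p)\<close>. For fixed \<open>t\<close> the levels with
  this property form a geometric sum controlled by the error. Conversely, the set of such
  \<open>t\<close> for fixed \<open>k\<close> has length half the measure, and this recovers the
  layered form of the integral of \<open>g powr \<tau>\<close>.\<close>

lemma bernstein_estimate:
  fixes g :: "'a \<Rightarrow> real" and \<sigma> :: "real \<Rightarrow> ennreal"
  assumes \<tau>: "0 < \<tau>" and p: "0 < p" and C: "0 < C"
    and g [measurable]: "g \<in> borel_measurable M" and g0: "\<And>x. 0 \<le> g x"
    and \<sigma>: "\<And>t \<theta>. 0 < t \<Longrightarrow> 0 < \<theta> \<Longrightarrow>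
       ennreal (\<theta> powr p) * emeasure M {x \<in> space M. \<theta> < g x}
         \<le> ennreal (\<theta> powr p * t) + ennreal C * ennpow (\<sigma> t) p"
  shows "(\<integral>\<^sup>+ x. ennreal (g x powr \<tau>) \<partial>M)
    \<le> ennreal (2 powr (\<tau> + 1) * (geom_const \<tau> * C powr (\<tau> / p)))
        * (\<integral>\<^sup>+ t. ennreal (t powr (- (\<tau> / p))) * ennpow (\<sigma> t) \<tau> * indicator {0<..} t \<partial>lborel)"
proof -
  define \<eta> where "\<eta> = \<tau> / p"
  have \<eta>: "0 < \<eta>" using \<tau> p by (auto simp: \<eta>_def)
  define N where "N \<theta> = emeasure M {x \<in> space M. \<theta> < g x}" for \<theta>
  define L where "L k = (2::real) powr (of_int k)" for k :: int
  define H where "H = geom_const \<tau> * C powr \<eta>"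
  have G: "0 < geom_const \<tau>" using \<tau> by (auto intro!: geom_const_pos)
  have H: "0 < H" using G C by (simp add: H_def)
  have L: "0 < L k" for k by (simp add: L_def)
  have L_powr: "L k powr a = 2 powr (a * of_int k)" for k a
    by (simp add: L_def powr_powr mult.commute)
  have [measurable]: "{t. 0 < t \<and> ennreal (2 * t) < y} \<in> sets borel" for y
    by measurable
  \<comment> \<open>The factor 2 leaves one copy of \<open>L k powr p * t\<close> after the finite
    term on the right is cancelled.\<close>
  have large: "ennreal (L k powr \<tau>) \<le> ennreal ((C / t) powr \<eta>) * ennpow (\<sigma> t) \<tau>"
    if t: "0 < t" and k: "ennreal (2 * t) < N (L k)" for t k
  proof -
    have "ennreal (L k powr p) * ennreal (2 * t) \<le> ennreal (L k powr p) * N (L k)"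
      using k by (intro mult_left_mono) auto
    also have "\<dots> \<le> ennreal (L k powr p * t) + ennreal C * ennpow (\<sigma> t) p"
      unfolding N_def by (rule \<sigma>[OF t L])
    finally have "ennreal (L k powr p * t) + ennreal (L k powr p * t)
        \<le> ennreal (L k powr p * t) + ennreal C * ennpow (\<sigma> t) p"
      using t by (simp add: mult_ac flip: ennreal_mult ennreal_plus)
    then have "ennreal (L k powr p * t) \<le> ennreal C * ennpow (\<sigma> t) p"
      by (subst (asm) ennreal_add_left_cancel_le) auto
    then have "ennreal (1 / t) * ennreal (L k powr p * t) \<le> ennreal (1 / t) * (ennreal C * ennpow (\<sigma> t) p)"
      by (intro mult_left_mono) auto
    then have "ennreal (L k powr p) \<le> ennreal (C / t) * ennpow (\<sigma> t) p"
      using t C by (simp add: mult.assoc[symmetric] flip: ennreal_mult)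
    then have "ennpow (ennreal (L k powr p)) \<eta> \<le> ennpow (ennreal (C / t) * ennpow (\<sigma> t) p) \<eta>"
      using \<eta> by (intro ennpow_mono) auto
    then show ?thesis
      using t C p by (simp add: ennpow_mult powr_powr \<eta>_def)
  qed
  \<comment> \<open>By \<open>large\<close> all contributing levels have weight at most
    \<open>y\<close>, so their sum is of order \<open>y\<close>. If \<open>y\<close> is 0 no level
    contributes.\<close>
  have level_sum: "(\<integral>\<^sup>+ k. ennreal (2 powr (\<tau> * of_int k)) * indicator {t. 0 < t \<and> ennreal (2 * t) < N (L k)} t \<partial>count_space UNIV)
      \<le> ennreal H * (ennreal (t powr (- \<eta>)) * ennpow (\<sigma> t) \<tau> * indicator {0<..} t)" for t
  proof (cases "0 < t")
    case t: True
    show ?thesis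
    proof (cases "ennpow (\<sigma> t) \<tau>")
      case (real s)
      define y where "y = (C / t) powr \<eta> * s"
      have le: "2 powr (\<tau> * of_int k) \<le> y" if "ennreal (2 * t) < N (L k)" for k
        using large[OF t that] real by (simp add: L_powr y_def flip: ennreal_mult)
      show ?thesis
      proof (cases "y = 0")
        case True
        then have "\<not> ennreal (2 * t) < N (L k)" for k
          using le[of k] by (auto simp: not_le)
        then show ?thesis by simp
      next
        case False
        then have y: "0 < y" using real by (simp add: y_def)
        have "(\<integral>\<^sup>+ k. ennreal (2 powr (\<tau> * of_int k)) * indicator {t. 0 < t \<and> ennreal (2 * t) < N (L k)} t \<partial>count_space UNIV)
          \<le> (\<integral>\<^sup>+ k. ennreal (2 powr (\<tau> * of_int k)) * indicator {k. 2 powr (\<tau> * of_int k) \<le> y} k \<partial>count_space UNIV)"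
          using le by (intro nn_integral_mono) (auto simp: indicator_def)
        also have "\<dots> \<le> ennreal (geom_const \<tau> * y)"
          using \<tau> y by (intro dyadic_level_sum_le) auto
        also have "geom_const \<tau> * y = H * (t powr (- \<eta>) * s)"
          using t C by (simp add: H_def y_def powr_divide powr_minus_divide)
        finally show ?thesis
          using t real H by (simp add: ennreal_mult)
      qed
    next
      case top
      with t H show ?thesis by (simp add: ennreal_mult_top)
    qed
  qed simp
  have "(\<integral>\<^sup>+ x. ennreal (g x powr \<tau>) \<partial>M)
      \<le> (\<integral>\<^sup>+ x. (\<integral>\<^sup>+ k. ennreal (2 powr \<tau> * 2 powr (\<tau> * of_int k)) * indicator {x \<in> space M. L k < g x} x \<partial>count_space UNIV) \<partial>M)"
  proof (rule nn_integral_mono)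
    fix x assume x: "x \<in> space M"
    show "ennreal (g x powr \<tau>) \<le> (\<integral>\<^sup>+ k. ennreal (2 powr \<tau> * 2 powr (\<tau> * of_int k)) * indicator {x \<in> space M. L k < g x} x \<partial>count_space UNIV)"
      (is "_ \<le> (\<integral>\<^sup>+ k. ?F k \<partial>count_space UNIV)")
    proof (cases "g x = 0")
      case False
      with g0[of x] have gx: "0 < g x" by simp
      \<comment> \<open>The ceiling minus 1 gives \<open>L k < g x \<le> 2 * L k\<close>, with the
        strict inequality on the left that the superlevel set demands.\<close>
      define k where "k = \<lceil>log 2 (g x)\<rceil> - 1"
      have k: "of_int k < log 2 (g x)" "log 2 (g x) \<le> of_int k + 1"
        unfolding k_def by linarith+
      have "L k < g x" using k(1) gx by (simp add: L_def less_log_iff)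
      moreover have "g x \<le> 2 * L k"
        using k(2) gx by (simp add: L_def log_le_iff powr_add)
      then have "g x powr \<tau> \<le> 2 powr \<tau> * 2 powr (\<tau> * of_int k)"
        using powr_mono2[of \<tau> "g x" "2 * L k"] \<tau> gx by (simp add: powr_mult L_powr)
      ultimately have "ennreal (g x powr \<tau>) \<le> ?F k"
        using x by (simp add: ennreal_leI)
      also have "\<dots> \<le> (\<integral>\<^sup>+ k. ?F k \<partial>count_space UNIV)"
        by (rule nn_integral_ge_point) simp
      finally show ?thesis .
    qed simp
  qed
  also have "\<dots> = (\<integral>\<^sup>+ k. (\<integral>\<^sup>+ x. ennreal (2 powr \<tau> * 2 powr (\<tau> * of_int k)) * indicator {x \<in> space M. L k < g x} x \<partial>M) \<partial>count_space UNIV)"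
    by (rule nn_integral_count_space_nn_integral) auto
  also have "\<dots> = (\<integral>\<^sup>+ k. ennreal (2 powr \<tau> * 2 powr (\<tau> * of_int k)) * N (L k) \<partial>count_space UNIV)"
    unfolding N_def by (intro nn_integral_cong, subst nn_integral_cmult_indicator) auto
  also have "\<dots> \<le> (\<integral>\<^sup>+ k. ennreal (2 powr (\<tau> + 1)) * (\<integral>\<^sup>+ t. ennreal (2 powr (\<tau> * of_int k)) * indicator {t. 0 < t \<and> ennreal (2 * t) < N (L k)} t \<partial>lborel) \<partial>count_space UNIV)"
  proof (rule nn_integral_mono)
    fix k
    \<comment> \<open>The factor 2 undoes the halving of the interval of admissible
      \<open>t\<close>; an infinite measure corresponds to the whole half-line.\<close>
    have "N (L k) \<le> 2 * emeasure lborel {t. 0 < t \<and> ennreal (2 * t) < N (L k)}"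
    proof (cases "N (L k)")
      case (real n)
      then have "{t. 0 < t \<and> ennreal (2 * t) < N (L k)} = {0<..<n / 2}"
        by (auto simp: ennreal_less_iff)
      with real show ?thesis by (simp flip: ennreal_numeral ennreal_mult)
    next
      case top
      then have "{t. 0 < t \<and> ennreal (2 * t) < N (L k)} = {0<..}" by auto
      then show ?thesis using top by (simp add: emeasure_lborel_greaterThan ennreal_mult_top)
    qed
    then have "ennreal (2 powr \<tau> * 2 powr (\<tau> * of_int k)) * N (L k)
       \<le> ennreal (2 powr \<tau> * 2 powr (\<tau> * of_int k)) * (2 * emeasure lborel {t. 0 < t \<and> ennreal (2 * t) < N (L k)})"
      by (intro mult_left_mono) auto
    also have "\<dots> = ennreal (2 powr (\<tau> + 1)) * (ennreal (2 powr (\<tau> * of_int k)) * emeasure lborel {t. 0 < t \<and> ennreal (2 * t) < N (L k)})"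
      by (simp add: powr_add ennreal_mult mult_ac)
    also have "\<dots> = ennreal (2 powr (\<tau> + 1)) * (\<integral>\<^sup>+ t. ennreal (2 powr (\<tau> * of_int k)) * indicator {t. 0 < t \<and> ennreal (2 * t) < N (L k)} t \<partial>lborel)"
      by (subst nn_integral_cmult_indicator) auto
    finally show "ennreal (2 powr \<tau> * 2 powr (\<tau> * of_int k)) * N (L k) \<le> \<dots>" .
  qed
  also have "\<dots> = ennreal (2 powr (\<tau> + 1)) * (\<integral>\<^sup>+ k. (\<integral>\<^sup>+ t. ennreal (2 powr (\<tau> * of_int k)) * indicator {t. 0 < t \<and> ennreal (2 * t) < N (L k)} t \<partial>lborel) \<partial>count_space UNIV)"
    by (rule nn_integral_cmult) simp
  also have "\<dots> = ennreal (2 powr (\<tau> + 1)) * (\<integral>\<^sup>+ t. (\<integral>\<^sup>+ k. ennreal (2 powr (\<tau> * of_int k)) * indicator {t. 0 < t \<and> ennreal (2 * t) < N (L k)} t \<partial>count_space UNIV) \<partial>lborel)"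
    by (subst nn_integral_count_space_nn_integral) auto
  also have "\<dots> \<le> ennreal (2 powr (\<tau> + 1)) * (ennreal H * (\<integral>\<^sup>+ t. ennreal (t powr (- \<eta>)) * ennpow (\<sigma> t) \<tau> * indicator {0<..} t \<partial>lborel))"
    \<comment> \<open>The integrand containing \<open>\<sigma>\<close> is not known to be
      measurable, whereas the sum over levels is.\<close>
    using H level_sum by (intro mult_left_mono nn_integral_le_cmult borel_measurable_count_space_sum) auto
  finally show ?thesis
    using H by (simp add: H_def \<eta>_def mult.assoc[symmetric] flip: ennreal_mult)
qed

section \<open>Identification of the approximation space\<close>

text \<open>Solving the inequality for \<open>F v\<close> gives a lower bound independent of
  \<open>v\<close>, which passes to the infimum without any continuity of \<open>ennpow\<close>. The
  subtraction is legitimate because \<open>ennreal y\<close> is finite.\<close>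

lemma le_add_ennpow_INF:
  assumes p: "0 < p" and C: "0 < C"
    and le: "\<And>v. v \<in> A \<Longrightarrow> x \<le> ennreal y + ennreal C * ennpow (F v) p"
  shows "x \<le> ennreal y + ennreal C * ennpow (INF v\<in>A. F v) p"
proof -
  have CC: "ennreal (1 / C) * ennreal C = 1" using C by (simp flip: ennreal_mult)
  define z where "z = ennreal (1 / C) * (x - ennreal y)"
  have z: "ennreal C * z = x - ennreal y"
    using CC by (simp add: z_def mult.assoc[symmetric] mult.commute)
  have "ennpow z (1 / p) \<le> F v" if "v \<in> A" for v
  proof -
    have "x - ennreal y \<le> ennreal C * ennpow (F v) p"
      using le[OF that] by (simp add: ennreal_minus_le_iff)
    then have "z \<le> ennreal (1 / C) * (ennreal C * ennpow (F v) p)"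
      unfolding z_def by (intro mult_left_mono) auto
    also have "\<dots> = ennpow (F v) p" by (simp add: CC flip: mult.assoc)
    finally show ?thesis using p by (simp add: ennpow_le_swap)
  qed
  then have "ennpow z (1 / p) \<le> (INF v\<in>A. F v)" by (rule INF_greatest)
  then have "z \<le> ennpow (INF v\<in>A. F v) p" using p by (simp add: ennpow_le_swap)
  then have "x - ennreal y \<le> ennreal C * ennpow (INF v\<in>A. F v) p"
    using mult_left_mono[of z _ "ennreal C"] z by simp
  then show ?thesis by (simp add: ennreal_minus_le_iff)
qed

text \<open>This is \<open>g\<close> of the overview. Here \<open>\<beta>\<close> is still free; it
  is a weight split off so that the same coefficients serve both quasi-norms.\<close>

definition amplitude :: "real \<Rightarrow> real \<Rightarrow> 'n::finite dyadic_seq \<Rightarrow> 'n dyadic \<Rightarrow> real" where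
  "amplitude s \<beta> u Q = vol Q powr (- s / real CARD('n) - 1 / 2 - \<beta>) * cmod (u Q)"

lemma amplitude_nonneg [simp]: "0 \<le> amplitude s \<beta> u Q"
  by (simp add: amplitude_def)

lemma amplitude_eq_0 [simp]: "amplitude s \<beta> u Q = 0 \<longleftrightarrow> u Q = 0"
  by (simp add: amplitude_def)

text \<open>The two exponents with \<open>recip q\<close> cancel, the indicators restrict the sum to
  the chain through \<open>x\<close>, and the powers of \<open>\<beta>\<close> cancel for any
  \<open>\<beta>\<close>.\<close>

lemma ennpow_f_qnorm:
  fixes u :: "'n::finite dyadic_seq"
  assumes p: "0 < p"
  shows "ennpow (f_qnorm s p q u) p = (\<integral>\<^sup>+ x. ennpow (lr_qnorm q {Q. x \<in> cube_set Q}
      (\<lambda>Q. ennreal (vol Q powr \<beta> * amplitude s \<beta> u Q))) p \<partial>lborel)"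
proof -
  have "lr_qnorm q UNIV (\<lambda>Q. ennreal
             (vol Q powr (- s / real CARD('n) + recip q - 1 / 2) * cmod (u Q)
              * (indicator (cube_set Q) x * vol Q powr (- recip q))))
     = lr_qnorm q {Q. x \<in> cube_set Q} (\<lambda>Q. ennreal (vol Q powr \<beta> * amplitude s \<beta> u Q))" for x
  proof -
    have "vol Q powr (- s / real CARD('n) + recip q - 1 / 2) * cmod (u Q) * vol Q powr (- recip q)
        = vol Q powr \<beta> * amplitude s \<beta> u Q" for Q
    proof -
      have "vol Q powr (- s / real CARD('n) + recip q - 1 / 2) * vol Q powr (- recip q)
          = vol Q powr \<beta> * vol Q powr (- s / real CARD('n) - 1 / 2 - \<beta>)"
        by (simp flip: powr_add)
      then show ?thesis by (simp add: amplitude_def mult_ac)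
    qed
    then show ?thesis
      by (subst lr_qnorm_restrict[where K = "{Q. x \<in> cube_set Q}"]) (auto intro!: lr_qnorm_cong)
  qed
  with p show ?thesis by (simp add: f_qnorm_def)
qed

lemma f_qnorm_0 [simp]: "f_qnorm s p q (\<lambda>_. 0) = 0"
  by (simp add: f_qnorm_def)

text \<open>Tonelli: each cube is counted on a set of measure \<open>vol Q\<close>.\<close>

lemma nn_integral_cube_sum:
  fixes f :: "'n::finite dyadic \<Rightarrow> ennreal"
  shows "(\<integral>\<^sup>+ x. (\<integral>\<^sup>+ Q. f Q \<partial>count_space {Q. x \<in> cube_set Q}) \<partial>lborel)
    = (\<integral>\<^sup>+ Q. f Q * ennreal (vol Q) \<partial>count_space UNIV)"
proof -
  have "(\<integral>\<^sup>+ x. (\<integral>\<^sup>+ Q. f Q \<partial>count_space {Q. x \<in> cube_set Q}) \<partial>lborel)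
      = (\<integral>\<^sup>+ x. (\<integral>\<^sup>+ Q. f Q * indicator (cube_set Q) x \<partial>count_space UNIV) \<partial>lborel)"
    by (subst nn_integral_count_space_indicator) (auto intro!: nn_integral_cong simp: indicator_def)
  also have "\<dots> = (\<integral>\<^sup>+ Q. (\<integral>\<^sup>+ x. f Q * indicator (cube_set Q) x \<partial>lborel) \<partial>count_space UNIV)"
    by (rule nn_integral_count_space_nn_integral) auto
  also have "\<dots> = (\<integral>\<^sup>+ Q. f Q * ennreal (vol Q) \<partial>count_space UNIV)"
    by (simp add: nn_integral_cmult_indicator emeasure_cube_set)
  finally show ?thesis .
qed

lemma borel_measurable_cube_sum:
  fixes f :: "'n::finite dyadic \<Rightarrow> ennreal"
  shows "(\<lambda>x. \<integral>\<^sup>+ Q. f Q \<partial>count_space {Q. x \<in> cube_set Q}) \<in> borel_measurable lborel"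
proof -
  have "(\<lambda>x. \<integral>\<^sup>+ Q. f Q \<partial>count_space {Q. x \<in> cube_set Q})
      = (\<lambda>x. \<integral>\<^sup>+ Q. f Q * indicator (cube_set Q) x \<partial>count_space UNIV)"
    by (subst nn_integral_count_space_indicator) (auto intro!: nn_integral_cong ext simp: indicator_def)
  then show ?thesis by (simp add: borel_measurable_count_space_sum)
qed

lemma space_nu [simp]: "space (nu \<alpha>) = UNIV" and sets_nu [simp]: "sets (nu \<alpha>) = UNIV"
  by (auto simp: nu_def)

lemma measurable_nu [simp]: "f \<in> borel_measurable (nu \<alpha>)"
  by (simp add: nu_def)

lemma nn_integral_nu: "(\<integral>\<^sup>+ Q. f Q \<partial>nu \<alpha>) = (\<integral>\<^sup>+ Q. ennreal (vol Q powr \<alpha>) * f Q \<partial>count_space UNIV)"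
  unfolding nu_def by (rule nn_integral_density) auto

section \<open>Two-sided control of the Triebel-Lizorkin quasi-norm by \<open>nu\<close>\<close>

context
  fixes p \<alpha> \<beta> s :: real and q :: ennreal
  assumes p: "0 < p" and q: "0 < q" and \<alpha>q: "\<alpha> \<noteq> 1 \<or> q = ennreal p"
    and \<beta>: "\<beta> = (\<alpha> - 1) / p"
begin

private lemma vol_powr: "vol (Q :: 'n::finite dyadic) powr \<beta> = 2 powr (- real CARD('n) * \<beta> * of_int (level Q))"
  by (simp add: vol_level powr_powr mult_ac)

text \<open>Translates the two cases of the theorem into those of the pointwise estimates: the
  weights along a chain have nonzero slope exactly when \<open>\<alpha>\<close> differs from
  1.\<close>

private lemma slope: "- real CARD('n::finite) * \<beta> \<noteq> 0 \<or> q = ennreal p"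
  using \<alpha>q p by (auto simp: \<beta>)

text \<open>The identity that dictates \<open>\<beta>\<close>: Lebesgue measure of a cube times the
  p-th power of its weight is its mass under \<open>nu\<close>.\<close>

private lemma vol_weight: "(vol Q powr \<beta>) powr p * vol Q = vol Q powr \<alpha>"
  using p vol_pos[of Q] powr_add[of "vol Q" "\<beta> * p" 1] by (simp add: powr_powr \<beta>)

text \<open>\<open>pointwise_lower\<close> integrated over all points;
  \<open>nn_integral_cube_sum\<close> and \<open>vol_weight\<close> turn the left side into the
  measure of a superlevel set.\<close>

lemma f_qnorm_lower:
  "\<exists>C>0. \<forall>(u :: 'n::finite dyadic_seq) \<theta>. 0 < \<theta> \<longrightarrow>
    ennreal (\<theta> powr p) * emeasure (nu \<alpha>) {Q. \<theta> < amplitude s \<beta> u Q}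
      \<le> ennreal C * ennpow (f_qnorm s p q u) p"
proof -
  obtain C where C: "0 < C" and pw: "\<And>K (l :: 'n dyadic \<Rightarrow> int) h g \<theta>. inj_on l K \<Longrightarrow> 0 < \<theta> \<Longrightarrow>
      \<forall>Q\<in>K. h Q = 2 powr (- real CARD('n) * \<beta> * of_int (l Q)) \<and> 0 \<le> g Q \<Longrightarrow>
      (\<integral>\<^sup>+ Q. ennreal (\<theta> powr p * h Q powr p) \<partial>count_space {Q\<in>K. \<theta> < g Q})
        \<le> ennreal C * ennpow (lr_qnorm q K (\<lambda>Q. ennreal (h Q * g Q))) p"
    using pointwise_lower[OF p q slope[where 'n = 'n], where 'a = "'n dyadic"] by meson
  show ?thesis
  proof (intro exI[of _ C] conjI C allI impI)
    fix u :: "'n dyadic_seq" and \<theta> :: real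
    assume \<theta>: "0 < \<theta>"
    let ?g = "amplitude s \<beta> u"
    let ?f = "\<lambda>Q :: 'n dyadic. ennreal (\<theta> powr p * (vol Q powr \<beta>) powr p) * indicator {Q. \<theta> < ?g Q} Q"
    have "ennreal (\<theta> powr p) * emeasure (nu \<alpha>) {Q. \<theta> < ?g Q}
        = (\<integral>\<^sup>+ Q. ennreal (\<theta> powr p) * indicator {Q. \<theta> < ?g Q} Q \<partial>nu \<alpha>)"
      by (subst nn_integral_cmult_indicator) auto
    also have "\<dots> = (\<integral>\<^sup>+ Q. ?f Q * ennreal (vol Q) \<partial>count_space UNIV)"
      unfolding nn_integral_nu vol_weight[symmetric]
      by (intro nn_integral_cong) (auto simp: indicator_def less_imp_le mult_ac simp flip: ennreal_mult)
    also have "\<dots> = (\<integral>\<^sup>+ x. (\<integral>\<^sup>+ Q. ?f Q \<partial>count_space {Q. x \<in> cube_set Q}) \<partial>lborel)"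
      by (rule nn_integral_cube_sum[symmetric])
    also have "\<dots> \<le> ennreal C * (\<integral>\<^sup>+ x. ennpow (lr_qnorm q {Q. x \<in> cube_set Q}
      (\<lambda>Q. ennreal (vol Q powr \<beta> * ?g Q))) p \<partial>lborel)"
    proof (intro nn_integral_le_cmult C borel_measurable_cube_sum)
      fix x :: "real ^ 'n"
      have "(\<integral>\<^sup>+ Q. ?f Q \<partial>count_space {Q. x \<in> cube_set Q})
        = (\<integral>\<^sup>+ Q. ennreal (\<theta> powr p * (vol Q powr \<beta>) powr p) \<partial>count_space {Q\<in>{Q. x \<in> cube_set Q}. \<theta> < ?g Q})"
        by (auto simp: nn_integral_count_space_indicator intro!: nn_integral_cong split: split_indicator)
      also have "\<dots> \<le> ennreal C * ennpow (lr_qnorm q {Q. x \<in> cube_set Q}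
            (\<lambda>Q. ennreal (vol Q powr \<beta> * ?g Q))) p"
        by (rule pw[OF inj_on_level \<theta>]) (simp add: vol_powr)
      finally show "(\<integral>\<^sup>+ Q. ?f Q \<partial>count_space {Q. x \<in> cube_set Q}) \<le> \<dots>" .
    qed
    finally show "ennreal (\<theta> powr p) * emeasure (nu \<alpha>) {Q. \<theta> < ?g Q} \<le> ennreal C * ennpow (f_qnorm s p q u) p"
      by (simp add: ennpow_f_qnorm[OF p, where \<beta> = \<beta>])
  qed
qed

text \<open>\<open>pointwise_upper\<close> integrated in the same way, for sequences whose
  amplitudes do not exceed the threshold.\<close>

lemma f_qnorm_upper:
  assumes \<epsilon>: "0 < \<epsilon>" "\<epsilon> < p"
  shows "\<exists>C>0. \<forall>(u :: 'n::finite dyadic_seq) \<theta>. 0 < \<theta> \<longrightarrow> (\<forall>Q. amplitude s \<beta> u Q \<le> \<theta>) \<longrightarrow>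
    ennpow (f_qnorm s p q u) p
      \<le> ennreal C * (\<integral>\<^sup>+ Q. ennreal (amplitude s \<beta> u Q powr (p - \<epsilon>) * \<theta> powr \<epsilon>) \<partial>nu \<alpha>)"
proof -
  obtain C where C: "0 < C" and pw: "\<And>K (l :: 'n dyadic \<Rightarrow> int) h g \<theta>. inj_on l K \<Longrightarrow> 0 < \<theta> \<Longrightarrow>
      \<forall>Q\<in>K. h Q = 2 powr (- real CARD('n) * \<beta> * of_int (l Q)) \<and> 0 \<le> g Q \<and> g Q \<le> \<theta> \<Longrightarrow>
      ennpow (lr_qnorm q K (\<lambda>Q. ennreal (h Q * g Q))) p
        \<le> ennreal C * (\<integral>\<^sup>+ Q. ennreal (h Q powr p * g Q powr (p - \<epsilon>) * \<theta> powr \<epsilon>) \<partial>count_space K)"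
    using pointwise_upper[OF \<epsilon> q slope[where 'n = 'n], where 'a = "'n dyadic"] by meson
  show ?thesis
  proof (intro exI[of _ C] conjI C allI impI)
    fix u :: "'n dyadic_seq" and \<theta> :: real
    assume \<theta>: "0 < \<theta>" and le: "\<forall>Q. amplitude s \<beta> u Q \<le> \<theta>"
    let ?g = "amplitude s \<beta> u"
    let ?f = "\<lambda>Q :: 'n dyadic. ennreal ((vol Q powr \<beta>) powr p * ?g Q powr (p - \<epsilon>) * \<theta> powr \<epsilon>)"
    have "ennpow (f_qnorm s p q u) p \<le> (\<integral>\<^sup>+ x. ennreal C * (\<integral>\<^sup>+ Q. ?f Q \<partial>count_space {Q. x \<in> cube_set Q}) \<partial>lborel)"
      unfolding ennpow_f_qnorm[OF p, where \<beta> = \<beta>]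
      by (intro nn_integral_mono pw[OF inj_on_level \<theta>]) (simp add: vol_powr le)
    also have "\<dots> = ennreal C * (\<integral>\<^sup>+ x. (\<integral>\<^sup>+ Q. ?f Q \<partial>count_space {Q. x \<in> cube_set Q}) \<partial>lborel)"
      by (intro nn_integral_cmult borel_measurable_cube_sum)
    also have "\<dots> = ennreal C * (\<integral>\<^sup>+ Q. ?f Q * ennreal (vol Q) \<partial>count_space UNIV)"
      by (simp only: nn_integral_cube_sum)
    also have "(\<integral>\<^sup>+ Q. ?f Q * ennreal (vol Q) \<partial>count_space UNIV)
        = (\<integral>\<^sup>+ Q. ennreal (?g Q powr (p - \<epsilon>) * \<theta> powr \<epsilon>) \<partial>nu \<alpha>)"
      unfolding nn_integral_nu vol_weight[symmetric]
      by (intro nn_integral_cong) (simp add: less_imp_le mult_ac flip: ennreal_mult)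
    finally show "ennpow (f_qnorm s p q u) p
      \<le> ennreal C * (\<integral>\<^sup>+ Q. ennreal (?g Q powr (p - \<epsilon>) * \<theta> powr \<epsilon>) \<partial>nu \<alpha>)" .
  qed
qed

end

text \<open>With equal inner and outer exponents the mixed norm collapses to one sum over all cubes,
  since the levels partition them. The hypothesis \<open>e\<close> is the balance of powers of the
  volume that leaves \<open>vol Q powr \<alpha>\<close> as the weight.\<close>

lemma ennpow_b_qnorm:
  fixes u :: "'n::finite dyadic_seq"
  assumes \<tau>: "0 < \<tau>" and e: "\<alpha> / \<tau> = - \<gamma> / real CARD('n) + 1 / \<tau> + s / real CARD('n) + \<beta>"
  shows "ennpow (b_qnorm \<gamma> (ennreal \<tau>) (ennreal \<tau>) u) \<tau>
    = (\<integral>\<^sup>+ Q. ennreal (amplitude s \<beta> u Q powr \<tau>) \<partial>nu \<alpha>)"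
proof -
  let ?e = "- \<gamma> / real CARD('n) + 1 / \<tau> - 1 / 2"
  let ?A = "\<lambda>j. {Q :: 'n dyadic. vol Q = 2 powr (- (real_of_int j * real CARD('n)))}"
  have A: "?A j = {Q. level Q = j}" for j
    by (auto simp: vol_level powr_inj)
  have "ennpow (b_qnorm \<gamma> (ennreal \<tau>) (ennreal \<tau>) u) \<tau>
     = (\<integral>\<^sup>+ j. (\<integral>\<^sup>+ Q. ennreal ((vol Q powr ?e * cmod (u Q)) powr \<tau>) \<partial>count_space (?A j)) \<partial>count_space UNIV)"
    using \<tau> by (simp add: b_qnorm_def lr_qnorm_def recip_def)
  also have "\<dots> = (\<integral>\<^sup>+ j. (\<integral>\<^sup>+ Q. ennreal ((vol Q powr ?e * cmod (u Q)) powr \<tau>) * indicator {level Q} j \<partial>count_space UNIV) \<partial>count_space UNIV)"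
    unfolding A by (rule nn_integral_cong, subst nn_integral_count_space_indicator)
      (auto intro!: nn_integral_cong simp: indicator_def)
  also have "\<dots> = (\<integral>\<^sup>+ Q. (\<integral>\<^sup>+ j. ennreal ((vol Q powr ?e * cmod (u Q)) powr \<tau>) * indicator {level Q} j \<partial>count_space UNIV) \<partial>count_space UNIV)"
    by (rule nn_integral_count_space_nn_integral) auto
  also have "\<dots> = (\<integral>\<^sup>+ Q. ennreal ((vol Q powr ?e * cmod (u Q)) powr \<tau>) \<partial>count_space UNIV)"
    by (simp add: nn_integral_cmult_indicator)
  also have "\<dots> = (\<integral>\<^sup>+ Q. ennreal (vol Q powr \<alpha>) * ennreal (amplitude s \<beta> u Q powr \<tau>) \<partial>count_space UNIV)"
  proof (intro nn_integral_cong)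
    fix Q :: "'n dyadic"
    have "?e = \<alpha> / \<tau> + (- s / real CARD('n) - 1 / 2 - \<beta>)"
      unfolding e by simp
    then have "vol Q powr ?e * cmod (u Q) = vol Q powr (\<alpha> / \<tau>) * amplitude s \<beta> u Q"
      by (simp only: amplitude_def powr_add mult.assoc)
    then have "(vol Q powr ?e * cmod (u Q)) powr \<tau> = vol Q powr \<alpha> * amplitude s \<beta> u Q powr \<tau>"
      using \<tau> by (simp add: powr_mult powr_powr)
    then show "ennreal ((vol Q powr ?e * cmod (u Q)) powr \<tau>) = ennreal (vol Q powr \<alpha>) * ennreal (amplitude s \<beta> u Q powr \<tau>)"
      by (simp add: ennreal_mult)
  qed
  finally show ?thesis by (simp add: nn_integral_nu)
qed

text \<open>The relation between \<open>\<tau>\<close>, \<open>\<xi>\<close> and \<open>p\<close>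
  gives \<open>\<xi> * \<tau> - 1 = - (\<tau> / p)\<close>, the weight in the two abstract
  estimates.\<close>

lemma ennpow_A_qnorm:
  assumes \<tau>: "0 < \<tau>" and \<xi>: "1 / \<tau> = \<xi> + 1 / p"
  shows "ennpow (A_qnorm \<xi> \<tau> N \<nu> u) \<tau>
    = (\<integral>\<^sup>+ t. ennreal (t powr (- (\<tau> / p))) * ennpow (approx_error N \<nu> t u) \<tau> * indicator {0<..} t \<partial>lborel)"
proof -
  have "\<xi> = 1 / \<tau> - 1 / p" using \<xi> by simp
  then have e: "\<xi> * \<tau> = 1 - \<tau> / p" using \<tau> by (simp add: left_diff_distrib)
  have "ennpow (ennreal (t powr \<xi>) * y) \<tau> * ennreal (1 / t) = ennreal (t powr (- (\<tau> / p))) * ennpow y \<tau>"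
    if t: "0 < t" for t y
  proof -
    have "(t powr \<xi>) powr \<tau> * (1 / t) = t powr (- (\<tau> / p))"
      using t by (simp add: powr_powr e powr_diff powr_minus_divide)
    then have "ennreal ((t powr \<xi>) powr \<tau>) * ennreal (1 / t) = ennreal (t powr (- (\<tau> / p)))"
      using t by (subst ennreal_mult[symmetric]) auto
    moreover have "ennpow (ennreal (t powr \<xi>) * y) \<tau> = ennreal ((t powr \<xi>) powr \<tau>) * ennpow y \<tau>"
      using t by (intro ennpow_mult) simp
    ultimately show ?thesis by (metis mult.assoc mult.commute)
  qed
  then show ?thesis
    using \<tau> by (auto simp: A_qnorm_def intro!: nn_integral_cong split: split_indicator)
qed

text \<open>The bounds are stated for every sequence, with infinite values allowed, so they give
  equality of the two spaces as well as equivalence of the quasi-norms.\<close>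

lemma A_qnorm_b_qnorm_bounds:
  fixes p \<alpha> s \<xi> \<tau> \<gamma> :: real and q :: ennreal
  assumes p: "0 < p" and q: "0 < q" and \<xi>: "0 < \<xi>" and \<tau>: "1 / \<tau> = \<xi> + 1 / p"
    and \<alpha>q: "\<alpha> \<noteq> 1 \<or> q = ennreal p" and \<gamma>: "\<gamma> = s + real CARD('n::finite) * \<xi> * (1 - \<alpha>)"
  shows "\<exists>D E. 0 < D \<and> 0 < E \<and> (\<forall>u :: 'n dyadic_seq.
      A_qnorm \<xi> \<tau> (f_qnorm s p q) (nu \<alpha>) u \<le> ennreal D * b_qnorm \<gamma> (ennreal \<tau>) (ennreal \<tau>) u \<and>
      b_qnorm \<gamma> (ennreal \<tau>) (ennreal \<tau>) u \<le> ennreal E * A_qnorm \<xi> \<tau> (f_qnorm s p q) (nu \<alpha>) u)"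
proof -
  have "0 < 1 / \<tau>" "1 / p < 1 / \<tau>" using \<tau> \<xi> p by (auto intro: add_pos_pos)
  then have \<tau>0: "0 < \<tau>" and \<tau>p: "\<tau> < p"
    using p by (auto simp: zero_less_divide_iff field_simps)
  \<comment> \<open>Any value strictly between 0 and \<open>p - \<tau>\<close> would serve; the
    midpoint is taken.\<close>
  define \<epsilon> where "\<epsilon> = (p - \<tau>) / 2"
  have \<epsilon>: "0 < \<epsilon>" "\<epsilon> < p - \<tau>" "\<epsilon> < p" using \<tau>p \<tau>0 by (auto simp: \<epsilon>_def)
  define \<beta> where "\<beta> = (\<alpha> - 1) / p"
  let ?g = "\<lambda>u :: 'n dyadic_seq. amplitude s \<beta> u"
  let ?A = "A_qnorm \<xi> \<tau> (f_qnorm s p q) (nu \<alpha>) :: 'n dyadic_seq \<Rightarrow> ennreal"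
  let ?b = "b_qnorm \<gamma> (ennreal \<tau>) (ennreal \<tau>) :: 'n dyadic_seq \<Rightarrow> ennreal"
  have b: "ennpow (?b u) \<tau> = (\<integral>\<^sup>+ Q. ennreal (?g u Q powr \<tau>) \<partial>nu \<alpha>)" for u
  proof (rule ennpow_b_qnorm[OF \<tau>0])
    have "\<gamma> / real CARD('n) = s / real CARD('n) + \<xi> * (1 - \<alpha>)"
      by (simp add: \<gamma> add_divide_distrib)
    moreover have "\<alpha> / \<tau> = \<alpha> * (\<xi> + 1 / p)"
      by (simp flip: \<tau>)
    ultimately show "\<alpha> / \<tau> = - \<gamma> / real CARD('n) + 1 / \<tau> + s / real CARD('n) + \<beta>"
      unfolding \<tau> by (simp add: \<beta>_def diff_divide_distrib algebra_simps)
  qed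
  note A = ennpow_A_qnorm[OF \<tau>0 \<tau>]
  obtain C1 where C1: "0 < C1" and upper: "\<And>(u :: 'n dyadic_seq) \<theta>. 0 < \<theta> \<Longrightarrow> (\<forall>Q. ?g u Q \<le> \<theta>) \<Longrightarrow>
    ennpow (f_qnorm s p q u) p \<le> ennreal C1 * (\<integral>\<^sup>+ Q. ennreal (?g u Q powr (p - \<epsilon>) * \<theta> powr \<epsilon>) \<partial>nu \<alpha>)"
    using f_qnorm_upper[OF p q \<alpha>q \<beta>_def \<epsilon>(1,3), where 'n = 'n] by meson
  obtain C2 where C2: "0 < C2" and lower: "\<And>(u :: 'n dyadic_seq) \<theta>. 0 < \<theta> \<Longrightarrow>
    ennreal (\<theta> powr p) * emeasure (nu \<alpha>) {Q. \<theta> < ?g u Q} \<le> ennreal C2 * ennpow (f_qnorm s p q u) p"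
    using f_qnorm_lower[OF p q \<alpha>q \<beta>_def, where 'n = 'n] by meson
  define D where "D = (geom_const \<tau> * 2 powr \<tau> + C1 * geom_const (- (p - \<tau> - \<epsilon>))) / (1 - \<tau> / p)"
  define E where "E = 2 powr (\<tau> + 1) * (geom_const \<tau> * C2 powr (\<tau> / p))"
  have "0 < geom_const \<tau>" "0 < geom_const (- (p - \<tau> - \<epsilon>))"
    using \<tau>0 \<epsilon> by (auto intro!: geom_const_pos)
  then have D: "0 < D" and E: "0 < E"
    using C1 C2 \<tau>p p by (auto simp: D_def E_def intro!: divide_pos_pos add_pos_pos mult_pos_pos)
  \<comment> \<open>The competitor is \<open>u\<close> itself restricted to an admissible set of
    cubes.\<close>
  have error_le: "approx_error (f_qnorm s p q) (nu \<alpha>) t u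
      \<le> f_qnorm s p q (\<lambda>Q. if Q \<in> \<Gamma> then 0 else u Q)"
    if "emeasure (nu \<alpha>) \<Gamma> \<le> ennreal t" for t \<Gamma> and u :: "'n dyadic_seq"
  proof -
    have "(\<lambda>Q. if Q \<in> \<Gamma> then u Q else 0) \<in> Sigma_approx (nu \<alpha>) t"
      unfolding Sigma_approx_def using that by blast
    then have "approx_error (f_qnorm s p q) (nu \<alpha>) t u
        \<le> f_qnorm s p q (\<lambda>Q. u Q - (if Q \<in> \<Gamma> then u Q else 0))"
      unfolding approx_error_def by (rule INF_lower)
    also have "(\<lambda>Q. u Q - (if Q \<in> \<Gamma> then u Q else 0)) = (\<lambda>Q. if Q \<in> \<Gamma> then 0 else u Q)"
      by auto
    finally show ?thesis .
  qed
  have AD: "ennpow (?A u) \<tau> \<le> ennreal D * ennpow (?b u) \<tau>" for u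
    unfolding A b D_def
  proof (rule jackson_estimate[OF \<tau>0 \<epsilon>(1,2) C1])
    fix t \<theta> :: real
    assume t: "0 < t" and \<theta>: "0 < \<theta>"
      and le: "emeasure (nu \<alpha>) {Q \<in> space (nu \<alpha>). \<theta> < ?g u Q} \<le> ennreal t"
    \<comment> \<open>The remainder after removing all amplitudes above \<open>\<theta>\<close>, so
      that the upper bound applies at this threshold.\<close>
    let ?u = "\<lambda>Q. if \<theta> < ?g u Q then 0 else u Q"
    have g: "?g ?u Q = (if \<theta> < ?g u Q then 0 else ?g u Q)" for Q
      by (simp add: amplitude_def)
    have "ennpow (approx_error (f_qnorm s p q) (nu \<alpha>) t u) p \<le> ennpow (f_qnorm s p q ?u) p"
      using p le error_le[of "{Q. \<theta> < ?g u Q}" t u] by (intro ennpow_mono) auto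
    also have "\<dots> \<le> ennreal C1 * (\<integral>\<^sup>+ Q. ennreal (?g ?u Q powr (p - \<epsilon>) * \<theta> powr \<epsilon>) \<partial>nu \<alpha>)"
      by (intro upper \<theta>) (simp add: g less_imp_le[OF \<theta>])
    also have "\<dots> = ennreal C1 * (\<integral>\<^sup>+ Q. ennreal (?g u Q powr (p - \<epsilon>) * \<theta> powr \<epsilon>) * indicator {Q. ?g u Q \<le> \<theta>} Q \<partial>nu \<alpha>)"
      unfolding g by (intro arg_cong2[where f = times] refl nn_integral_cong) (simp add: indicator_def)
    finally show "ennpow (approx_error (f_qnorm s p q) (nu \<alpha>) t u) p \<le> \<dots>" .
  next
    fix t :: real
    assume t: "0 < t" and le: "emeasure (nu \<alpha>) {Q \<in> space (nu \<alpha>). 0 < ?g u Q} \<le> ennreal t"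
    have "(\<lambda>Q. if Q \<in> {Q. 0 < ?g u Q} then 0 else u Q) = (\<lambda>_. 0)"
      using amplitude_nonneg[of s \<beta> u] amplitude_eq_0[of s \<beta> u] by (fastforce simp: less_le)
    with error_le[of "{Q. 0 < ?g u Q}" t u] le
    show "approx_error (f_qnorm s p q) (nu \<alpha>) t u = 0" by simp
  qed auto
  have BE: "ennpow (?b u) \<tau> \<le> ennreal E * ennpow (?A u) \<tau>" for u
    unfolding A b E_def
  proof (rule bernstein_estimate[OF \<tau>0 p C2])
    fix t \<theta> :: real
    assume t: "0 < t" and \<theta>: "0 < \<theta>"
    show "ennreal (\<theta> powr p) * emeasure (nu \<alpha>) {Q \<in> space (nu \<alpha>). \<theta> < ?g u Q}
        \<le> ennreal (\<theta> powr p * t) + ennreal C2 * ennpow (approx_error (f_qnorm s p q) (nu \<alpha>) t u) p"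
      unfolding approx_error_def
    proof (rule le_add_ennpow_INF[OF p C2])
      fix v :: "'n dyadic_seq" assume "v \<in> Sigma_approx (nu \<alpha>) t"
      then obtain \<Gamma> c where v: "v = (\<lambda>Q. if Q \<in> \<Gamma> then c Q else 0)" and \<Gamma>: "emeasure (nu \<alpha>) \<Gamma> \<le> ennreal t"
        unfolding Sigma_approx_def by blast
      let ?B = "{Q. \<theta> < ?g (\<lambda>Q. u Q - v Q) Q}"
      \<comment> \<open>Off the support set of \<open>v\<close> the differences agree with
        \<open>u\<close>, so a large amplitude of \<open>u\<close> there is a large amplitude of the
        error.\<close>
      have "{Q. \<theta> < ?g u Q} \<subseteq> \<Gamma> \<union> ?B"
        by (auto simp: v amplitude_def)
      then have "emeasure (nu \<alpha>) {Q. \<theta> < ?g u Q} \<le> emeasure (nu \<alpha>) (\<Gamma> \<union> ?B)"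
        by (intro emeasure_mono) auto
      also have "\<dots> \<le> ennreal t + emeasure (nu \<alpha>) ?B"
        using \<Gamma> by (intro order_trans[OF emeasure_subadditive]) (auto intro: add_right_mono)
      finally have "ennreal (\<theta> powr p) * emeasure (nu \<alpha>) {Q. \<theta> < ?g u Q}
          \<le> ennreal (\<theta> powr p) * (ennreal t + emeasure (nu \<alpha>) ?B)"
        by (intro mult_left_mono) auto
      also have "\<dots> = ennreal (\<theta> powr p * t) + ennreal (\<theta> powr p) * emeasure (nu \<alpha>) ?B"
        using t by (simp add: distrib_left ennreal_mult)
      also have "\<dots> \<le> ennreal (\<theta> powr p * t) + ennreal C2 * ennpow (f_qnorm s p q (\<lambda>Q. u Q - v Q)) p"
        by (intro add_left_mono lower \<theta>)
      finally show "ennreal (\<theta> powr p) * emeasure (nu \<alpha>) {Q \<in> space (nu \<alpha>). \<theta> < ?g u Q} \<le> \<dots>"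
        by simp
    qed
  qed auto
  have root: "x \<le> ennreal (c powr (1 / \<tau>)) * y"
    if "ennpow x \<tau> \<le> ennreal c * ennpow y \<tau>" "0 < c" for x y c
    using ennpow_mono[OF _ that(1), of "1 / \<tau>"] that(2) \<tau>0 by (simp add: ennpow_mult)
  show ?thesis
    using root[OF AD D] root[OF BE E] D E
    by (intro exI[of _ "D powr (1 / \<tau>)"] exI[of _ "E powr (1 / \<tau>)"]) auto
qed

theorem corollary2p10p6:
  fixes s1 s2 p1 p2 \<xi> \<alpha> \<tau> \<gamma> :: real and q1 :: ennreal
  assumes "0 < p1" and "0 < p2" and "0 < q1" and "0 < \<xi>"
    and \<alpha>: "\<alpha> = p1 * ((s2 - s1) / real CARD('n::finite) - 1 / p2) + 1"
    and \<tau>: "1 / \<tau> = \<xi> + 1 / p1"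
  shows "(\<alpha> \<noteq> 1 \<and> \<gamma> = s1 + real CARD('n) * \<xi> * (1 - \<alpha>) \<longrightarrow>
            A_space \<xi> \<tau> (f_qnorm s1 p1 q1) (nu \<alpha>)
              = (b_space \<gamma> (ennreal \<tau>) (ennreal \<tau>) :: 'n dyadic_seq set) \<and>
            equivalent_qnorms_on (b_space \<gamma> (ennreal \<tau>) (ennreal \<tau>))
              (A_qnorm \<xi> \<tau> (f_qnorm s1 p1 q1) (nu \<alpha>))
              (b_qnorm \<gamma> (ennreal \<tau>) (ennreal \<tau>) :: 'n dyadic_seq \<Rightarrow> ennreal)) \<and>
         (\<alpha> = 1 \<and> q1 = ennreal p1 \<and> \<gamma> = s1 \<longrightarrow>
            A_space \<xi> \<tau> (f_qnorm s1 p1 q1) (nu \<alpha>)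
              = (b_space \<gamma> (ennreal \<tau>) (ennreal \<tau>) :: 'n dyadic_seq set) \<and>
            equivalent_qnorms_on (b_space \<gamma> (ennreal \<tau>) (ennreal \<tau>))
              (A_qnorm \<xi> \<tau> (f_qnorm s1 p1 q1) (nu \<alpha>))
              (b_qnorm \<gamma> (ennreal \<tau>) (ennreal \<tau>) :: 'n dyadic_seq \<Rightarrow> ennreal))"
proof -
  let ?A = "A_qnorm \<xi> \<tau> (f_qnorm s1 p1 q1) (nu \<alpha>) :: 'n dyadic_seq \<Rightarrow> ennreal"
  let ?b = "b_qnorm \<gamma> (ennreal \<tau>) (ennreal \<tau>) :: 'n dyadic_seq \<Rightarrow> ennreal"
  \<comment> \<open>One argument covers both cases, because the formula for \<open>\<gamma>\<close>
    reduces to \<open>s1\<close> when \<open>\<alpha>\<close> is 1.\<close>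
  have main: "A_space \<xi> \<tau> (f_qnorm s1 p1 q1) (nu \<alpha>) = (b_space \<gamma> (ennreal \<tau>) (ennreal \<tau>) :: 'n dyadic_seq set)
      \<and> equivalent_qnorms_on (b_space \<gamma> (ennreal \<tau>) (ennreal \<tau>)) ?A ?b"
    if \<alpha>q: "\<alpha> \<noteq> 1 \<or> q1 = ennreal p1" and \<gamma>: "\<gamma> = s1 + real CARD('n) * \<xi> * (1 - \<alpha>)"
  proof -
    obtain D E where DE: "0 < D" "0 < E" and le: "\<And>u. ?A u \<le> ennreal D * ?b u" "\<And>u. ?b u \<le> ennreal E * ?A u"
      using A_qnorm_b_qnorm_bounds[OF assms(1,3,4) \<tau> \<alpha>q \<gamma>] by blast
    have "?A u < \<infinity> \<longleftrightarrow> ?b u < \<infinity>" for u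
      using le[of u] by (metis ennreal_less_top ennreal_mult_less_top infinity_ennreal_def order_le_less_trans)
    moreover have "ennreal (1 / E) * ?b u \<le> ?A u" for u
    proof -
      have "ennreal (1 / E) * ?b u \<le> ennreal (1 / E) * (ennreal E * ?A u)"
        by (intro mult_left_mono le) auto
      also have "\<dots> = ?A u" using DE by (simp flip: ennreal_mult mult.assoc)
      finally show ?thesis .
    qed
    ultimately show ?thesis
      using DE le(1) unfolding A_space_def b_space_def equivalent_qnorms_on_def
      by (intro conjI exI[of _ "1 / E"] exI[of _ D]) auto
  qed
  from main show ?thesis by auto
qed

end
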